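(* Let $\Bbbk$ be a commutative ring, let $A$ be an associative unital $\Bbbk$-algebra which is projective as a $\Bbbk$-module, and let $\delta:A\to A$ be a $\Bbbk$-linear derivation. If $M$ is a left $A$-module and $f:M\to M$ is a $\delta$-operator on $M$, then there is a canonical morphism of graded $\Bbbk$-modules $$\nabla_f^\bullet:\operatorname{Ext}_A^\bullet(M,M)\to\operatorname{Ext}_A^\bullet(M,M)$$ such that for each projective resolution $\epsilon:P_\bullet\to M$ of $M$ by left $A$-modules and each $\delta$-lifting $f_\bullet:P_\bullet\to P_\bullet$ of $f$ to $P_\bullet$ the diagram $$\begin{array}{ccc} H(\hom_A(P_\bullet,M)) & \xrightarrow{\ \nabla^\bullet_{f,P_\bullet}\ } & H(\hom_A(P_\bullet,M))\\ \downarrow{\cong} & & \downarrow{\cong}\\ \operatorname{Ext}_A^\bullet(M,M) & \xrightarrow{\ \nabla^\bullet_f\ } & \operatorname{Ext}_A^\bullet(M,M)\end{array}$$ commutes, where the vertical arrows are the canonical isomorphisms and $\nabla^\bullet_{f,P_\bullet}$ is the map induced on cohomology by $f_\bullet^\sharp$.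
   Context: Linear means $\Bbbk$-linear. A $\delta$-operator on a left $A$-module $M$ is a linear map $f:M\to M$ such that $f(am)=\delta(a)m+af(m)$ for all $a\in A$, $m\in M$. If $f$ is a $\delta$-operator on $M$ and $\epsilon:P_\bullet\to M$ is a projective resolution with differentials $d_i:P_i\to P_{i-1}$, a $\delta$-lifting of $f$ to $P_\bullet$ is a sequence $f_\bullet=(f_i)_{i\ge0}$ of $\delta$-operators $f_i:P_i\to P_i$ such that $\epsilon f_0=f\epsilon$ and $d_if_i=f_{i-1}d_i$ for all $i\ge1$. Given a $\delta$-lifting $f_\bullet$ of $f$, for each $i\geq0$ and $\phi\in\hom_A(P_i,M)$ the map $f_i^\sharp(\phi):P_i\to M$, $f_i^\sharp(\phi)(p)=f(\phi(p))-\phi(f_i(p))$, is $A$-linear, and the maps $f_i^\sharp$ form a morphism of complexes of $\Bbbk$-modules $f_\bullet^\sharp:\hom_A(P_\bullet,M)\to\hom_A(P_\bullet,M)$. The map it induces on cohomology is denoted $\nabla^\bullet_{f,P_\bullet}$ (it does not depend on the choice of the $\delta$-lifting $f_\bullet$). *)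

theory Defs
  imports "HOL-Algebra.Module" "HOL-Algebra.AbelCoset"
begin

section \<open>Left modules over a possibly noncommutative ring\<close>

text \<open>The library locale \<^locale>\<open>module\<close> requires a commutative base ring.\<close>

locale left_module = R?: ring R + M?: abelian_group M for R (structure) and M (structure) +
  assumes smult_closed [simp, intro]:
      "\<lbrakk>a \<in> carrier R; x \<in> carrier M\<rbrakk> \<Longrightarrow> a \<odot>\<^bsub>M\<^esub> x \<in> carrier M"
    and smult_l_distr:
      "\<lbrakk>a \<in> carrier R; b \<in> carrier R; x \<in> carrier M\<rbrakk> \<Longrightarrow>
        (a \<oplus> b) \<odot>\<^bsub>M\<^esub> x = a \<odot>\<^bsub>M\<^esub> x \<oplus>\<^bsub>M\<^esub> b \<odot>\<^bsub>M\<^esub> x"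
    and smult_r_distr:
      "\<lbrakk>a \<in> carrier R; x \<in> carrier M; y \<in> carrier M\<rbrakk> \<Longrightarrow>
        a \<odot>\<^bsub>M\<^esub> (x \<oplus>\<^bsub>M\<^esub> y) = a \<odot>\<^bsub>M\<^esub> x \<oplus>\<^bsub>M\<^esub> a \<odot>\<^bsub>M\<^esub> y"
    and smult_assoc:
      "\<lbrakk>a \<in> carrier R; b \<in> carrier R; x \<in> carrier M\<rbrakk> \<Longrightarrow>
        (a \<otimes> b) \<odot>\<^bsub>M\<^esub> x = a \<odot>\<^bsub>M\<^esub> (b \<odot>\<^bsub>M\<^esub> x)"
    and smult_one [simp]: "x \<in> carrier M \<Longrightarrow> \<one> \<odot>\<^bsub>M\<^esub> x = x"

definition linear_map ::
  "('r, 'x) ring_scheme \<Rightarrow> ('r, 'm, 'y) module_scheme \<Rightarrow> ('r, 'n, 'z) module_scheme \<Rightarrow> ('m \<Rightarrow> 'n) \<Rightarrow> bool"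
  where "linear_map R M N h \<longleftrightarrow>
    h \<in> carrier M \<rightarrow> carrier N \<and>
    (\<forall>x\<in>carrier M. \<forall>y\<in>carrier M. h (x \<oplus>\<^bsub>M\<^esub> y) = h x \<oplus>\<^bsub>N\<^esub> h y) \<and>
    (\<forall>a\<in>carrier R. \<forall>x\<in>carrier M. h (a \<odot>\<^bsub>M\<^esub> x) = a \<odot>\<^bsub>N\<^esub> h x)"

definition linear_iso ::
  "('r, 'x) ring_scheme \<Rightarrow> ('r, 'm, 'y) module_scheme \<Rightarrow> ('r, 'n, 'z) module_scheme \<Rightarrow> ('m \<Rightarrow> 'n) \<Rightarrow> bool"
  where "linear_iso R M N h \<longleftrightarrow> linear_map R M N h \<and> bij_betw h (carrier M) (carrier N)"

text \<open>Projectivity is the lifting property against surjections \<open>N \<rightarrow> N'\<close>. A definition cannot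
  quantify over types, so \<open>N\<close> and \<open>N'\<close> have types that accommodate the canonical surjection from
  the free module on the carrier of \<open>P\<close> onto \<open>P\<close>; lemma \<open>projective_module_lift\<close> below
  derives the lifting property for modules \<open>N\<close> and \<open>N'\<close> of arbitrary types.\<close>

definition projective_module :: "('r, 'x) ring_scheme \<Rightarrow> ('r, 'p) module \<Rightarrow> bool"
  where "projective_module R P \<longleftrightarrow> left_module R P \<and>
    (\<forall>(N :: ('r, 'p \<Rightarrow> 'r) module) (N' :: ('r, 'p) module) g h.
      left_module R N \<longrightarrow> left_module R N' \<longrightarrow>
      linear_map R N N' g \<longrightarrow> g ` carrier N = carrier N' \<longrightarrow> linear_map R P N' h \<longrightarrow>
      (\<exists>h'. linear_map R P N h' \<and> (\<forall>p\<in>carrier P. g (h' p) = h p)))"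

definition quotient_module :: "('r, 'm) module \<Rightarrow> 'm set \<Rightarrow> ('r, 'm set) module"
  where "quotient_module M S =
    \<lparr>carrier = a_rcosets\<^bsub>M\<^esub> S, mult = undefined, one = undefined,
     zero = S, add = (\<lambda>X Y. X <+>\<^bsub>M\<^esub> Y),
     smult = (\<lambda>c X. \<Union>x\<in>X. S +>\<^bsub>M\<^esub> (c \<odot>\<^bsub>M\<^esub> x))\<rparr>"


lemma linear_mapD:
  assumes "linear_map R M N h"
  shows "x \<in> carrier M \<Longrightarrow> h x \<in> carrier N"
    and "x \<in> carrier M \<Longrightarrow> y \<in> carrier M \<Longrightarrow> h (x \<oplus>\<^bsub>M\<^esub> y) = h x \<oplus>\<^bsub>N\<^esub> h y"
    and "a \<in> carrier R \<Longrightarrow> x \<in> carrier M \<Longrightarrow> h (a \<odot>\<^bsub>M\<^esub> x) = a \<odot>\<^bsub>N\<^esub> h x"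
  using assms by (auto simp: linear_map_def)

lemma linear_map_zero:
  assumes "linear_map R M N h" "left_module R M" "left_module R N"
  shows "h \<zero>\<^bsub>M\<^esub> = \<zero>\<^bsub>N\<^esub>"
proof -
  interpret M: left_module R M by fact
  interpret N: left_module R N by fact
  have "h \<zero>\<^bsub>M\<^esub> \<oplus>\<^bsub>N\<^esub> h \<zero>\<^bsub>M\<^esub> = h \<zero>\<^bsub>M\<^esub>"
    using linear_mapD(2)[OF assms(1), of "\<zero>\<^bsub>M\<^esub>" "\<zero>\<^bsub>M\<^esub>"] by simp
  then show ?thesis
    using N.M.add.l_cancel_one[of "h \<zero>\<^bsub>M\<^esub>" "h \<zero>\<^bsub>M\<^esub>"] linear_mapD(1)[OF assms(1)] by simp
qed

lemma (in left_module) smult_l_null: "x \<in> carrier M \<Longrightarrow> \<zero> \<odot>\<^bsub>M\<^esub> x = \<zero>\<^bsub>M\<^esub>"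
  using smult_l_distr[of \<zero> \<zero> x] by simp

lemma (in left_module) smult_r_null: "a \<in> carrier R \<Longrightarrow> a \<odot>\<^bsub>M\<^esub> \<zero>\<^bsub>M\<^esub> = \<zero>\<^bsub>M\<^esub>"
  using smult_r_distr[of a "\<zero>\<^bsub>M\<^esub>" "\<zero>\<^bsub>M\<^esub>"] by simp

lemma (in left_module) finsum_smult:
  assumes "finite B" "a \<in> carrier R" "g \<in> B \<rightarrow> carrier M"
  shows "a \<odot>\<^bsub>M\<^esub> (\<Oplus>\<^bsub>M\<^esub>x\<in>B. g x) = (\<Oplus>\<^bsub>M\<^esub>x\<in>B. a \<odot>\<^bsub>M\<^esub> g x)"
  using assms by (induction B rule: finite_induct) (auto simp: smult_r_null smult_r_distr Pi_def)

lemma finsum_linear: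
  assumes "linear_map R M N h" "left_module R M" "left_module R N"
    and "finite B" "g \<in> B \<rightarrow> carrier M"
  shows "h (\<Oplus>\<^bsub>M\<^esub>x\<in>B. g x) = (\<Oplus>\<^bsub>N\<^esub>x\<in>B. h (g x))"
proof -
  interpret M: left_module R M by fact
  interpret N: left_module R N by fact
  from assms(4,5) show ?thesis
  proof (induction B rule: finite_induct)
    case empty
    show ?case using linear_map_zero[OF assms(1-3)] by simp
  next
    case (insert x B)
    have "(\<lambda>x. h (g x)) \<in> insert x B \<rightarrow> carrier N"
      using insert.prems linear_mapD(1)[OF assms(1)] by auto
    then show ?case using insert linear_mapD(2)[OF assms(1)] by (auto simp: Pi_def)
  qed
qed

lemma linear_map_cong:
  assumes "linear_map R M N h" "left_module R M" "\<And>x. x \<in> carrier M \<Longrightarrow> h' x = h x"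
  shows "linear_map R M N h'"
proof -
  interpret M: left_module R M by fact
  show ?thesis using assms(1,3) by (simp add: linear_map_def Pi_def)
qed

lemma linear_map_comp:
  "linear_map R M N h \<Longrightarrow> linear_map R N L g \<Longrightarrow> linear_map R M L (\<lambda>x. g (h x))"
  by (auto simp: linear_map_def Pi_def)


section \<open>Free modules\<close>

text \<open>Finitely supported functions on \<open>X\<close>, extended by zero outside \<open>X\<close>.\<close>

definition free_module :: "('r, 'x) ring_scheme \<Rightarrow> 'b set \<Rightarrow> ('r, 'b \<Rightarrow> 'r) module"
  where "free_module R X =
    \<lparr>carrier = {u. (\<forall>x. u x \<in> carrier R) \<and> {x. u x \<noteq> \<zero>\<^bsub>R\<^esub>} \<subseteq> X \<and> finite {x. u x \<noteq> \<zero>\<^bsub>R\<^esub>}},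
     mult = undefined, one = undefined,
     zero = (\<lambda>_. \<zero>\<^bsub>R\<^esub>), add = (\<lambda>u v x. u x \<oplus>\<^bsub>R\<^esub> v x),
     smult = (\<lambda>a u x. a \<otimes>\<^bsub>R\<^esub> u x)\<rparr>"

definition free_lift ::
  "('r, 'x) ring_scheme \<Rightarrow> ('r, 'm, 'y) module_scheme \<Rightarrow> ('b \<Rightarrow> 'm) \<Rightarrow> ('b \<Rightarrow> 'r) \<Rightarrow> 'm"
  where "free_lift R M g u = (\<Oplus>\<^bsub>M\<^esub>x\<in>{x. u x \<noteq> \<zero>\<^bsub>R\<^esub>}. u x \<odot>\<^bsub>M\<^esub> g x)"

lemma free_module_left_module:
  assumes "ring R"
  shows "left_module R (free_module R X)"
proof -
  interpret ring R by fact
  have "abelian_group (free_module R X)"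
  proof (rule abelian_groupI)
    fix u v assume u: "u \<in> carrier (free_module R X)" and v: "v \<in> carrier (free_module R X)"
    have "{x. u x \<oplus>\<^bsub>R\<^esub> v x \<noteq> \<zero>\<^bsub>R\<^esub>} \<subseteq> {x. u x \<noteq> \<zero>\<^bsub>R\<^esub>} \<union> {x. v x \<noteq> \<zero>\<^bsub>R\<^esub>}" by auto
    with u v show "u \<oplus>\<^bsub>free_module R X\<^esub> v \<in> carrier (free_module R X)"
      by (auto simp: free_module_def intro: finite_subset[of _ "{x. u x \<noteq> \<zero>\<^bsub>R\<^esub>} \<union> {x. v x \<noteq> \<zero>\<^bsub>R\<^esub>}"])
  next
    fix u assume u: "u \<in> carrier (free_module R X)"
    then have "(\<lambda>x. \<ominus>\<^bsub>R\<^esub> u x) \<in> carrier (free_module R X)"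
      by (auto simp: free_module_def intro: finite_subset[of _ "{x. u x \<noteq> \<zero>\<^bsub>R\<^esub>}"])
    moreover have "(\<lambda>x. \<ominus>\<^bsub>R\<^esub> u x) \<oplus>\<^bsub>free_module R X\<^esub> u = \<zero>\<^bsub>free_module R X\<^esub>"
      using u by (auto simp: free_module_def l_neg)
    ultimately show "\<exists>y\<in>carrier (free_module R X). y \<oplus>\<^bsub>free_module R X\<^esub> u = \<zero>\<^bsub>free_module R X\<^esub>"
      by blast
  qed (auto simp: free_module_def intro!: ext intro: a_assoc a_comm)
  then show ?thesis
  proof (intro left_module.intro left_module_axioms.intro assms)
    fix a u assume "a \<in> carrier R" "u \<in> carrier (free_module R X)"
    then show "a \<odot>\<^bsub>free_module R X\<^esub> u \<in> carrier (free_module R X)"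
      by (auto simp: free_module_def intro: finite_subset[of _ "{x. u x \<noteq> \<zero>\<^bsub>R\<^esub>}"])
  qed (auto simp: free_module_def l_distr r_distr m_assoc)
qed

lemma free_lift_superset:
  assumes "left_module R M" "u \<in> carrier (free_module R X)" "g \<in> X \<rightarrow> carrier M"
    and "finite B" "{x. u x \<noteq> \<zero>\<^bsub>R\<^esub>} \<subseteq> B" "B \<subseteq> X"
  shows "free_lift R M g u = (\<Oplus>\<^bsub>M\<^esub>x\<in>B. u x \<odot>\<^bsub>M\<^esub> g x)"
proof -
  interpret M: left_module R M by fact
  show ?thesis
    unfolding free_lift_def
    by (rule M.M.add.finprod_mono_neutral_cong_left)
       (use assms in \<open>auto simp: free_module_def M.smult_l_null Pi_def subset_iff\<close>)
qed

lemma free_lift_linear: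
  fixes X :: "'b set"
  assumes "left_module R M" "g \<in> X \<rightarrow> carrier M"
  shows "linear_map R (free_module R X) M (free_lift R M g)"
proof -
  interpret M: left_module R M by fact
  let ?F = "free_module R X" and ?s = "\<lambda>u :: 'b \<Rightarrow> 'a. {x. u x \<noteq> \<zero>\<^bsub>R\<^esub>}"
  interpret F: left_module R ?F by (rule free_module_left_module) unfold_locales
  have fin: "finite (?s u)" "?s u \<subseteq> X" "\<And>x. u x \<in> carrier R" if "u \<in> carrier ?F" for u
    using that by (auto simp: free_module_def)
  have g: "u x \<odot>\<^bsub>M\<^esub> g x \<in> carrier M" if "u \<in> carrier ?F" "x \<in> X" for u x
    using fin[OF that(1)] assms(2) that by auto
  have "free_lift R M g u \<in> carrier M" if u: "u \<in> carrier ?F" for u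
    unfolding free_lift_def using g[OF u] fin[OF u] by (intro M.M.finsum_closed) auto
  moreover have "free_lift R M g (u \<oplus>\<^bsub>?F\<^esub> v) = free_lift R M g u \<oplus>\<^bsub>M\<^esub> free_lift R M g v"
    if u: "u \<in> carrier ?F" and v: "v \<in> carrier ?F" for u v
  proof -
    let ?B = "?s u \<union> ?s v"
    have B: "finite ?B" "?B \<subseteq> X" using fin[OF u] fin[OF v] by auto
    have uv: "u \<oplus>\<^bsub>?F\<^esub> v \<in> carrier ?F" using u v by simp
    have "?s (u \<oplus>\<^bsub>?F\<^esub> v) \<subseteq> ?B" by (auto simp: free_module_def)
    then have "free_lift R M g (u \<oplus>\<^bsub>?F\<^esub> v) = (\<Oplus>\<^bsub>M\<^esub>x\<in>?B. (u \<oplus>\<^bsub>?F\<^esub> v) x \<odot>\<^bsub>M\<^esub> g x)"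
      by (intro free_lift_superset[OF assms(1) uv assms(2) B(1)] B)
    also have "\<dots> = (\<Oplus>\<^bsub>M\<^esub>x\<in>?B. u x \<odot>\<^bsub>M\<^esub> g x \<oplus>\<^bsub>M\<^esub> v x \<odot>\<^bsub>M\<^esub> g x)"
    proof (rule M.M.finsum_cong')
      fix x assume "x \<in> ?B"
      then have "x \<in> X" using B by auto
      then have "g x \<in> carrier M" using assms(2) by auto
      then show "(u \<oplus>\<^bsub>?F\<^esub> v) x \<odot>\<^bsub>M\<^esub> g x = u x \<odot>\<^bsub>M\<^esub> g x \<oplus>\<^bsub>M\<^esub> v x \<odot>\<^bsub>M\<^esub> g x"
        using fin(3)[OF u] fin(3)[OF v] by (simp add: free_module_def M.smult_l_distr)
    qed (use B g[OF u] g[OF v] in auto)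
    also have "\<dots> = (\<Oplus>\<^bsub>M\<^esub>x\<in>?B. u x \<odot>\<^bsub>M\<^esub> g x) \<oplus>\<^bsub>M\<^esub> (\<Oplus>\<^bsub>M\<^esub>x\<in>?B. v x \<odot>\<^bsub>M\<^esub> g x)"
      using B g[OF u] g[OF v] by (intro M.M.finsum_addf) auto
    also have "\<dots> = free_lift R M g u \<oplus>\<^bsub>M\<^esub> free_lift R M g v"
      using free_lift_superset[OF assms(1) u assms(2) B(1) _ B(2)]
        free_lift_superset[OF assms(1) v assms(2) B(1) _ B(2)] by auto
    finally show ?thesis .
  qed
  moreover have "free_lift R M g (a \<odot>\<^bsub>?F\<^esub> u) = a \<odot>\<^bsub>M\<^esub> free_lift R M g u"
    if a: "a \<in> carrier R" and u: "u \<in> carrier ?F" for a u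
  proof -
    have "?s (a \<odot>\<^bsub>?F\<^esub> u) \<subseteq> ?s u" using a by (auto simp: free_module_def)
    then have "free_lift R M g (a \<odot>\<^bsub>?F\<^esub> u) = (\<Oplus>\<^bsub>M\<^esub>x\<in>?s u. (a \<odot>\<^bsub>?F\<^esub> u) x \<odot>\<^bsub>M\<^esub> g x)"
      using fin[OF u] a u by (intro free_lift_superset[OF assms(1) _ assms(2)]) auto
    also have "\<dots> = (\<Oplus>\<^bsub>M\<^esub>x\<in>?s u. a \<odot>\<^bsub>M\<^esub> (u x \<odot>\<^bsub>M\<^esub> g x))"
    proof (rule M.M.finsum_cong')
      fix x assume "x \<in> ?s u"
      then have "x \<in> X" using fin[OF u] by auto
      then have "g x \<in> carrier M" using assms(2) by auto
      then show "(a \<odot>\<^bsub>?F\<^esub> u) x \<odot>\<^bsub>M\<^esub> g x = a \<odot>\<^bsub>M\<^esub> (u x \<odot>\<^bsub>M\<^esub> g x)"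
        using a fin(3)[OF u] by (simp add: free_module_def M.smult_assoc)
    qed (use a g[OF u] fin[OF u] in auto)
    also have "\<dots> = a \<odot>\<^bsub>M\<^esub> free_lift R M g u"
      unfolding free_lift_def using a g[OF u] fin[OF u] by (intro M.finsum_smult[symmetric]) auto
    finally show ?thesis .
  qed
  ultimately show ?thesis by (auto simp: linear_map_def)
qed

definition unit_vector :: "('r, 'x) ring_scheme \<Rightarrow> 'b \<Rightarrow> 'b \<Rightarrow> 'r"
  where "unit_vector R x = (\<lambda>y. if y = x then \<one>\<^bsub>R\<^esub> else \<zero>\<^bsub>R\<^esub>)"

lemma unit_vector_closed:
  assumes "ring R" "x \<in> X"
  shows "unit_vector R x \<in> carrier (free_module R X)"
proof -
  interpret ring R by fact
  show ?thesis using assms(2)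
    by (auto simp: unit_vector_def free_module_def intro: finite_subset[of _ "{x}"])
qed

lemma free_lift_unit_vector:
  assumes "left_module R M" "g \<in> X \<rightarrow> carrier M" "x \<in> X"
  shows "free_lift R M g (unit_vector R x) = g x"
proof -
  interpret M: left_module R M by fact
  have "free_lift R M g (unit_vector R x) = (\<Oplus>\<^bsub>M\<^esub>y\<in>{x}. unit_vector R x y \<odot>\<^bsub>M\<^esub> g y)"
    using assms(3)
    by (intro free_lift_superset[OF assms(1) unit_vector_closed assms(2)])
       (auto simp: unit_vector_def M.R.ring_axioms)
  also have "\<dots> = g x"
  proof -
    have "g x \<in> carrier M" using assms(2,3) by auto
    then show ?thesis
      using M.M.finsum_insert[of "{}" x "\<lambda>y. unit_vector R x y \<odot>\<^bsub>M\<^esub> g y"]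
      by (simp add: unit_vector_def)
  qed
  finally show ?thesis .
qed

lemma linear_free_lift:
  assumes "linear_map R M N h" "left_module R M" "left_module R N"
    and "g \<in> X \<rightarrow> carrier M" "u \<in> carrier (free_module R X)"
  shows "h (free_lift R M g u) = free_lift R N (\<lambda>x. h (g x)) u"
proof -
  interpret M: left_module R M by fact
  interpret N: left_module R N by fact
  have u: "finite {x. u x \<noteq> \<zero>\<^bsub>R\<^esub>}" "{x. u x \<noteq> \<zero>\<^bsub>R\<^esub>} \<subseteq> X" "\<And>x. u x \<in> carrier R"
    using assms(5) by (auto simp: free_module_def)
  have g: "g x \<in> carrier M" if "u x \<noteq> \<zero>\<^bsub>R\<^esub>" for x using that u assms(4) by auto
  have "h (free_lift R M g u) = (\<Oplus>\<^bsub>N\<^esub>x\<in>{x. u x \<noteq> \<zero>\<^bsub>R\<^esub>}. h (u x \<odot>\<^bsub>M\<^esub> g x))"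
    unfolding free_lift_def using u g by (intro finsum_linear[OF assms(1-3)]) auto
  also have "\<dots> = free_lift R N (\<lambda>x. h (g x)) u"
    unfolding free_lift_def using u g linear_mapD[OF assms(1)]
    by (intro N.M.finsum_cong') auto
  finally show ?thesis .
qed

lemma free_module_lift:
  assumes "left_module R N" "left_module R N'" "linear_map R N N' g" "g ` carrier N = carrier N'"
    and "t \<in> X \<rightarrow> carrier N'"
  shows "\<exists>h'. linear_map R (free_module R X) N h' \<and>
    (\<forall>u\<in>carrier (free_module R X). g (h' u) = free_lift R N' t u)"
proof -
  interpret N': left_module R N' by fact
  have "\<forall>x\<in>X. \<exists>y\<in>carrier N. g y = t x" 
  proof
    fix x assume "x \<in> X"
    then have "t x \<in> g ` carrier N" using assms(4,5) by auto
    then show "\<exists>y\<in>carrier N. g y = t x" by auto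
  qed
  then obtain s where s: "\<And>x. x \<in> X \<Longrightarrow> s x \<in> carrier N \<and> g (s x) = t x" by metis
  have s': "s \<in> X \<rightarrow> carrier N" using s by auto
  have "g (free_lift R N s u) = free_lift R N' t u" if u: "u \<in> carrier (free_module R X)" for u
  proof -
    have "g (free_lift R N s u) = free_lift R N' (\<lambda>x. g (s x)) u"
      by (rule linear_free_lift[OF assms(3,1,2) s' u])
    also have "\<dots> = free_lift R N' t u"
      unfolding free_lift_def using u s assms(5)
      by (intro N'.M.finsum_cong') (auto simp: free_module_def Pi_def subset_iff)
    finally show ?thesis .
  qed
  then show ?thesis using free_lift_linear[OF assms(1) s'] by auto
qed

lemma projective_module_lift:
  assumes P: "projective_module R P"
    and "left_module R N" "left_module R N'" "linear_map R N N' g" "g ` carrier N = carrier N'"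
    and h: "linear_map R P N' h"
  shows "\<exists>h'. linear_map R P N h' \<and> (\<forall>p\<in>carrier P. g (h' p) = h p)"
proof -
  have PM: "left_module R P" using P by (simp add: projective_module_def)
  interpret P: left_module R P by fact
  let ?F = "free_module R (carrier P)" and ?e = "free_lift R P (\<lambda>p. p)"
  have F: "left_module R ?F" by (rule free_module_left_module) unfold_locales
  have e: "linear_map R ?F P ?e" by (rule free_lift_linear[OF PM]) auto
  have "p \<in> ?e ` carrier ?F" if "p \<in> carrier P" for p
  proof (rule image_eqI)
    show "p = ?e (unit_vector R p)"
      using free_lift_unit_vector[OF PM, of "\<lambda>p. p" "carrier P" p] that by simp
    show "unit_vector R p \<in> carrier ?F" by (rule unit_vector_closed[OF P.R.ring_axioms that])
  qed
  then have surj: "?e ` carrier ?F = carrier P" using linear_mapD(1)[OF e] by auto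
  have id: "linear_map R P P (\<lambda>p. p)" by (auto simp: linear_map_def)
  have "\<exists>s. linear_map R P ?F s \<and> (\<forall>p\<in>carrier P. ?e (s p) = p)"
    by (rule P[unfolded projective_module_def, THEN conjunct2, rule_format, OF F PM e surj id])
  then obtain s where s: "linear_map R P ?F s" "\<And>p. p \<in> carrier P \<Longrightarrow> ?e (s p) = p" by auto
  have hP: "h \<in> carrier P \<rightarrow> carrier N'" using h by (simp add: linear_map_def)
  obtain k where k: "linear_map R ?F N k"
    "\<And>u. u \<in> carrier ?F \<Longrightarrow> g (k u) = free_lift R N' h u"
    using free_module_lift[OF assms(2-5) hP] by auto
  have "g (k (s p)) = h p" if p: "p \<in> carrier P" for p
    using k(2) linear_free_lift[OF h PM assms(3), of "\<lambda>p. p" "carrier P" "s p"]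
      linear_mapD(1)[OF s(1) p] s(2)[OF p] by simp
  then show ?thesis
    by (intro exI[of _ "\<lambda>p. k (s p)"] conjI linear_map_comp[OF s(1) k(1)] ballI)
qed

lemma free_module_projective:
  assumes "ring R"
  shows "projective_module R (free_module R X)"
proof -
  have F: "left_module R (free_module R X)" by (rule free_module_left_module[OF assms])
  interpret F: left_module R "free_module R X" by fact
  let ?F = "free_module R X"
  have ex: "free_lift R ?F (unit_vector R) u = u" if u: "u \<in> carrier ?F" for u
  proof
    fix y
    have fin: "finite {x. u x \<noteq> \<zero>\<^bsub>R\<^esub>}" "{x. u x \<noteq> \<zero>\<^bsub>R\<^esub>} \<subseteq> X" "\<And>x. u x \<in> carrier R"
      using u by (auto simp: free_module_def)
    have *: "(\<Oplus>\<^bsub>?F\<^esub>x\<in>B. u x \<odot>\<^bsub>?F\<^esub> unit_vector R x) y = (if y \<in> B then u y else \<zero>\<^bsub>R\<^esub>)"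
      if "finite B" "B \<subseteq> X" for B
      using that
    proof (induction B rule: finite_induct)
      case empty
      show ?case by (simp only: F.M.finsum_empty) (simp add: free_module_def)
    next
      case (insert x B)
      have "(\<lambda>x. u x \<odot>\<^bsub>?F\<^esub> unit_vector R x) \<in> insert x B \<rightarrow> carrier ?F"
        using insert.prems fin(3) by (intro funcsetI F.smult_closed unit_vector_closed[OF assms]) auto
      then have "(\<Oplus>\<^bsub>?F\<^esub>x\<in>insert x B. u x \<odot>\<^bsub>?F\<^esub> unit_vector R x) =
          (u x \<odot>\<^bsub>?F\<^esub> unit_vector R x) \<oplus>\<^bsub>?F\<^esub> (\<Oplus>\<^bsub>?F\<^esub>x\<in>B. u x \<odot>\<^bsub>?F\<^esub> unit_vector R x)"
        using insert.hyps by (intro F.M.finsum_insert) auto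
      then show ?case
        using insert fin by (auto simp: free_module_def unit_vector_def)
    qed
    show "free_lift R ?F (unit_vector R) u y = u y"
      unfolding free_lift_def using *[OF fin(1,2)] by simp
  qed
  show ?thesis unfolding projective_module_def
  proof (intro conjI allI impI)
    fix N :: "('a, ('c \<Rightarrow> 'a) \<Rightarrow> 'a) module" and N' :: "('a, 'c \<Rightarrow> 'a) module" and g h
    assume N: "left_module R N" "left_module R N'" "linear_map R N N' g"
      "g ` carrier N = carrier N'" and h: "linear_map R ?F N' h"
    have ev: "unit_vector R \<in> X \<rightarrow> carrier ?F" using unit_vector_closed[OF assms] by auto
    then have "(\<lambda>x. h (unit_vector R x)) \<in> X \<rightarrow> carrier N'" using linear_mapD(1)[OF h] by auto
    from free_module_lift[OF N this] obtain h' where h': "linear_map R ?F N h'"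
      "\<And>u. u \<in> carrier ?F \<Longrightarrow> g (h' u) = free_lift R N' (\<lambda>x. h (unit_vector R x)) u" by auto
    have "g (h' u) = h u" if "u \<in> carrier ?F" for u
      using linear_free_lift[OF h F N(2) ev that] h'(2)[OF that] ex[OF that] by simp
    then show "\<exists>h'. linear_map R ?F N h' \<and> (\<forall>u\<in>carrier ?F. g (h' u) = h u)"
      by (intro exI[of _ h'] conjI h'(1) ballI)
  qed (rule F)
qed


section \<open>Projective resolutions\<close>

text \<open>The value \<open>d 0\<close> plays no role.\<close>

definition projective_resolution ::
  "('r, 'x) ring_scheme \<Rightarrow> ('r, 'm, 'y) module_scheme \<Rightarrow>
   (nat \<Rightarrow> ('r, 'p) module) \<Rightarrow> (nat \<Rightarrow> 'p \<Rightarrow> 'p) \<Rightarrow> ('p \<Rightarrow> 'm) \<Rightarrow> bool"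
  where "projective_resolution R M P d \<epsilon> \<longleftrightarrow>
    (\<forall>i. projective_module R (P i)) \<and>
    linear_map R (P 0) M \<epsilon> \<and>
    (\<forall>i. linear_map R (P (Suc i)) (P i) (d (Suc i))) \<and>
    \<epsilon> ` carrier (P 0) = carrier M \<and>
    d 1 ` carrier (P 1) = {p \<in> carrier (P 0). \<epsilon> p = \<zero>\<^bsub>M\<^esub>} \<and>
    (\<forall>i. d (Suc (Suc i)) ` carrier (P (Suc (Suc i))) =
          {p \<in> carrier (P (Suc i)). d (Suc i) p = \<zero>\<^bsub>P i\<^esub>})"

text \<open>Morphisms of resolutions over the identity of the resolved module.\<close>

definition comparison_map ::
  "('r, 'x) ring_scheme \<Rightarrow>
   (nat \<Rightarrow> ('r, 'p) module) \<Rightarrow> (nat \<Rightarrow> 'p \<Rightarrow> 'p) \<Rightarrow> ('p \<Rightarrow> 'm) \<Rightarrow>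
   (nat \<Rightarrow> ('r, 'q) module) \<Rightarrow> (nat \<Rightarrow> 'q \<Rightarrow> 'q) \<Rightarrow> ('q \<Rightarrow> 'm) \<Rightarrow> (nat \<Rightarrow> 'p \<Rightarrow> 'q) \<Rightarrow> bool"
  where "comparison_map R P d \<epsilon> Q d' \<epsilon>' \<alpha> \<longleftrightarrow>
    (\<forall>i. linear_map R (P i) (Q i) (\<alpha> i)) \<and>
    (\<forall>p\<in>carrier (P 0). \<epsilon>' (\<alpha> 0 p) = \<epsilon> p) \<and>
    (\<forall>i. \<forall>p\<in>carrier (P (Suc i)). d' (Suc i) (\<alpha> (Suc i) p) = \<alpha> i (d (Suc i) p))"

text \<open>The canonical free resolution used to define Ext: \<open>F\<^sub>0\<close> is free on (labels for) the
  elements of \<open>M\<close>, and \<open>F\<^sub>n\<^sub>+\<^sub>1\<close> is free on labels for the elements of the kernel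
  of the preceding map. For all the \<open>F\<^sub>n\<close> to live in one type, an element of such a kernel is
  labelled by the formal sums \<open>\<Sum> a\<^sub>i t\<^sub>i\<close> presenting it, so it may have several labels.
  Lemma \<open>std_resolution_projective_resolution\<close> confirms that this is a projective resolution.\<close>

datatype ('r, 'm) label = Gen 'm | Syz "('r \<times> ('r, 'm) label) list"

definition formal_sum :: "('r, 'x) ring_scheme \<Rightarrow> ('r \<times> 'b) list \<Rightarrow> 'b \<Rightarrow> 'r"
  where "formal_sum R l = foldr (\<lambda>(a, t) u. u(t := a \<oplus>\<^bsub>R\<^esub> u t)) l (\<lambda>_. \<zero>\<^bsub>R\<^esub>)"

definition std_aug ::
  "('r, 'x) ring_scheme \<Rightarrow> ('r, 'm, 'y) module_scheme \<Rightarrow> (('r, 'm) label \<Rightarrow> 'r) \<Rightarrow> 'm"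
  where "std_aug R M = free_lift R M (\<lambda>t. case t of Gen m \<Rightarrow> m | Syz l \<Rightarrow> \<zero>\<^bsub>M\<^esub>)"

text \<open>The same formula gives the differential in every positive degree.\<close>

definition std_diff ::
  "('r, 'x) ring_scheme \<Rightarrow> (('r, 'm) label \<Rightarrow> 'r) \<Rightarrow> (('r, 'm) label \<Rightarrow> 'r)"
  where "std_diff R = free_lift R (free_module R UNIV)
    (\<lambda>t. case t of Gen m \<Rightarrow> (\<lambda>_. \<zero>\<^bsub>R\<^esub>) | Syz l \<Rightarrow> formal_sum R l)"

fun std_labels ::
  "('r, 'x) ring_scheme \<Rightarrow> ('r, 'm, 'y) module_scheme \<Rightarrow> nat \<Rightarrow> ('r, 'm) label set"
  where
    "std_labels R M 0 = Gen ` carrier M"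
  | "std_labels R M (Suc n) =
      {Syz l | l. set l \<subseteq> carrier R \<times> std_labels R M n \<and>
        (if n = 0 then std_aug R M (formal_sum R l) = \<zero>\<^bsub>M\<^esub>
         else std_diff R (formal_sum R l) = (\<lambda>_. \<zero>\<^bsub>R\<^esub>))}"

definition std_resolution ::
  "('r, 'x) ring_scheme \<Rightarrow> ('r, 'm, 'y) module_scheme \<Rightarrow> nat \<Rightarrow> ('r, ('r, 'm) label \<Rightarrow> 'r) module"
  where "std_resolution R M n = free_module R (std_labels R M n)"

lemma formal_sum_simps [simp]:
  "formal_sum R [] = (\<lambda>_. \<zero>\<^bsub>R\<^esub>)"
  "formal_sum R ((a, t) # l) = (formal_sum R l)(t := a \<oplus>\<^bsub>R\<^esub> formal_sum R l t)"
  by (simp_all add: formal_sum_def)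

lemma formal_sum_closed:
  assumes "ring R" "set l \<subseteq> carrier R \<times> X"
  shows "formal_sum R l \<in> carrier (free_module R X)"
proof -
  interpret ring R by fact
  show ?thesis
    using assms(2)
  proof (induction l)
    case (Cons p l)
    obtain a t where p: "p = (a, t)" by (cases p)
    have "{x. ((formal_sum R l)(t := a \<oplus>\<^bsub>R\<^esub> formal_sum R l t)) x \<noteq> \<zero>\<^bsub>R\<^esub>} \<subseteq>
        insert t {x. formal_sum R l x \<noteq> \<zero>\<^bsub>R\<^esub>}" by auto
    with Cons p show ?case
      by (auto simp: free_module_def
          intro: finite_subset[of _ "insert t {x. formal_sum R l x \<noteq> \<zero>\<^bsub>R\<^esub>}"])
  qed (auto simp: free_module_def)
qed

lemma formal_sum_surj:
  assumes "ring R" "u \<in> carrier (free_module R X)"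
  shows "\<exists>l. set l \<subseteq> carrier R \<times> X \<and> formal_sum R l = u"
proof -
  interpret ring R by fact
  have u: "finite {x. u x \<noteq> \<zero>\<^bsub>R\<^esub>}" "{x. u x \<noteq> \<zero>\<^bsub>R\<^esub>} \<subseteq> X" "\<And>x. u x \<in> carrier R"
    using assms(2) by (auto simp: free_module_def)
  obtain xs where xs: "set xs = {x. u x \<noteq> \<zero>\<^bsub>R\<^esub>}" "distinct xs"
    using finite_distinct_list[OF u(1)] by auto
  have "formal_sum R (map (\<lambda>x. (u x, x)) ys) = (\<lambda>x. if x \<in> set ys then u x else \<zero>\<^bsub>R\<^esub>)"
    if "distinct ys" for ys
    using that u(3) by (induction ys) auto
  from this[OF xs(2)] have "formal_sum R (map (\<lambda>x. (u x, x)) xs) = u" using xs(1) by auto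
  then show ?thesis using xs(1) u by (intro exI[of _ "map (\<lambda>x. (u x, x)) xs"]) auto
qed

lemma free_module_UNIV_iff:
  "u \<in> carrier (free_module R X) \<longleftrightarrow>
    u \<in> carrier (free_module R UNIV) \<and> {x. u x \<noteq> \<zero>\<^bsub>R\<^esub>} \<subseteq> X"
  by (auto simp: free_module_def)

lemma free_lift_subset:
  assumes "left_module R (free_module R Y)" "g \<in> X \<rightarrow> carrier (free_module R Y)"
    and "u \<in> carrier (free_module R X)"
  shows "free_lift R (free_module R UNIV) g u = free_lift R (free_module R Y) g u"
proof -
  interpret Y: left_module R "free_module R Y" by fact
  interpret U: left_module R "free_module R (UNIV :: 'c set)"
    by (rule free_module_left_module) unfold_locales
  have "linear_map R (free_module R Y) (free_module R (UNIV :: 'c set)) (\<lambda>v. v)"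
    by (auto simp: linear_map_def free_module_def)
  from linear_free_lift[OF this assms(1) U.left_module_axioms assms(2,3)] show ?thesis by simp
qed

lemma std_resolution_projective_resolution:
  assumes "left_module R M"
  shows "projective_resolution R M (std_resolution R M) (\<lambda>_. std_diff R) (std_aug R M)"
proof -
  interpret M: left_module R M by fact
  let ?L = "std_labels R M" and ?F = "std_resolution R M"
  let ?g = "\<lambda>t :: ('a, 'c) label. case t of Gen m \<Rightarrow> (\<lambda>_. \<zero>\<^bsub>R\<^esub>) | Syz l \<Rightarrow> formal_sum R l"
  let ?h = "\<lambda>t :: ('a, 'c) label. case t of Gen m \<Rightarrow> m | Syz l \<Rightarrow> \<zero>\<^bsub>M\<^esub>"
  have F: "left_module R (?F n)" for n
    unfolding std_resolution_def by (rule free_module_left_module) unfold_locales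
  have z: "\<zero>\<^bsub>?F n\<^esub> = (\<lambda>_. \<zero>\<^bsub>R\<^esub>)" for n by (simp add: std_resolution_def free_module_def)
  have g: "?g \<in> ?L (Suc n) \<rightarrow> carrier (?F n)" for n
    unfolding std_resolution_def using formal_sum_closed[OF M.R.ring_axioms] by auto
  have h: "?h \<in> ?L 0 \<rightarrow> carrier M" by auto
  have aug: "linear_map R (?F 0) M (std_aug R M)"
    unfolding std_aug_def std_resolution_def by (rule free_lift_linear[OF assms h])
  have eq: "std_diff R u = free_lift R (?F n) ?g u" if "u \<in> carrier (?F (Suc n))" for u n
    using free_lift_subset[OF F[unfolded std_resolution_def] g[unfolded std_resolution_def]
        that[unfolded std_resolution_def]]
    by (simp add: std_resolution_def std_diff_def)
  have lin: "linear_map R (?F (Suc n)) (?F n) (free_lift R (?F n) ?g)" for n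
    unfolding std_resolution_def[of R M "Suc n"] by (rule free_lift_linear[OF F g])
  have diff: "linear_map R (?F (Suc n)) (?F n) (std_diff R)" for n
    using linear_map_cong[OF lin F] eq by blast
  have surj: "std_aug R M ` carrier (?F 0) = carrier M"
  proof
    show "std_aug R M ` carrier (?F 0) \<subseteq> carrier M" using linear_mapD(1)[OF aug] by auto
    show "carrier M \<subseteq> std_aug R M ` carrier (?F 0)"
    proof
      fix m assume "m \<in> carrier M"
      then have "Gen m \<in> ?L 0" by simp
      then have "std_aug R M (unit_vector R (Gen m)) = m"
        and "unit_vector R (Gen m) \<in> carrier (?F 0)"
        unfolding std_aug_def std_resolution_def
        using free_lift_unit_vector[OF assms h] unit_vector_closed[OF M.R.ring_axioms] by simp_all
      then show "m \<in> std_aug R M ` carrier (?F 0)" by (metis image_eqI)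
    qed
  qed
  have exact: "std_diff R ` carrier (?F (Suc n)) = {u \<in> carrier (?F n). \<theta> u = \<zero>\<^bsub>N\<^esub>}"
    if N: "left_module R N" and \<theta>: "linear_map R (?F n) N \<theta>"
      and L: "?L (Suc n) = {Syz l | l. set l \<subseteq> carrier R \<times> ?L n \<and> \<theta> (formal_sum R l) = \<zero>\<^bsub>N\<^esub>}"
    for n and N :: "('a, 'n, 'z) module_scheme" and \<theta>
  proof -
    interpret N: left_module R N by fact
    have "\<theta> (std_diff R u) = \<zero>\<^bsub>N\<^esub>" if u: "u \<in> carrier (?F (Suc n))" for u
    proof -
      have "\<theta> (std_diff R u) = free_lift R N (\<lambda>t. \<theta> (?g t)) u"
        unfolding eq[OF u]
        using linear_free_lift[OF \<theta> F N g] u by (simp add: std_resolution_def)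
      also have "\<dots> = (\<Oplus>\<^bsub>N\<^esub>x\<in>{x. u x \<noteq> \<zero>\<^bsub>R\<^esub>}. \<zero>\<^bsub>N\<^esub>)"
        unfolding free_lift_def
      proof (rule N.M.finsum_cong')
        fix x assume "x \<in> {x. u x \<noteq> \<zero>\<^bsub>R\<^esub>}"
        with u have "x \<in> ?L (Suc n)"
          by (auto simp: std_resolution_def free_module_def simp del: std_labels.simps)
        then have "\<theta> (?g x) = \<zero>\<^bsub>N\<^esub>" unfolding L by auto
        moreover have "u x \<in> carrier R" using u by (simp add: std_resolution_def free_module_def)
        ultimately show "u x \<odot>\<^bsub>N\<^esub> \<theta> (?g x) = \<zero>\<^bsub>N\<^esub>" by (simp add: N.smult_r_null)
      qed auto
      finally show ?thesis by simp
    qed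
    moreover have "u \<in> std_diff R ` carrier (?F (Suc n))"
      if u: "u \<in> carrier (?F n)" "\<theta> u = \<zero>\<^bsub>N\<^esub>" for u
    proof -
      obtain l where l: "set l \<subseteq> carrier R \<times> ?L n" "formal_sum R l = u"
        using formal_sum_surj[OF M.R.ring_axioms, of u "?L n"] u by (auto simp: std_resolution_def)
      then have "Syz l \<in> ?L (Suc n)" using L u by auto
      then have "unit_vector R (Syz l) \<in> carrier (?F (Suc n))"
        and "free_lift R (?F n) ?g (unit_vector R (Syz l)) = u"
        using free_lift_unit_vector[OF F g] unit_vector_closed[OF M.R.ring_axioms] l(2)
        by (auto simp: std_resolution_def simp del: std_labels.simps)
      then show ?thesis using eq by (metis image_eqI)
    qed
    ultimately show ?thesis using linear_mapD(1)[OF diff] by blast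
  qed
  show ?thesis
    unfolding projective_resolution_def
  proof (intro conjI allI)
    show "projective_module R (?F i)" for i
      unfolding std_resolution_def by (rule free_module_projective) unfold_locales
    show "std_diff R ` carrier (?F 1) = {p \<in> carrier (?F 0). std_aug R M p = \<zero>\<^bsub>M\<^esub>}"
      using exact[OF assms aug] by simp
    show "std_diff R ` carrier (?F (Suc (Suc i))) =
        {p \<in> carrier (?F (Suc i)). std_diff R p = \<zero>\<^bsub>?F i\<^esub>}" for i
      by (rule exact[OF F diff]) (simp add: z)
  qed (fact aug diff surj)+
qed


section \<open>Cohomology of cochain complexes\<close>

definition cocycles ::
  "(nat \<Rightarrow> ('k, 'c) module) \<Rightarrow> (nat \<Rightarrow> 'c \<Rightarrow> 'c) \<Rightarrow> nat \<Rightarrow> 'c set"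
  where "cocycles C d n = {x \<in> carrier (C n). d n x = \<zero>\<^bsub>C (Suc n)\<^esub>}"

definition coboundaries ::
  "(nat \<Rightarrow> ('k, 'c) module) \<Rightarrow> (nat \<Rightarrow> 'c \<Rightarrow> 'c) \<Rightarrow> nat \<Rightarrow> 'c set"
  where "coboundaries C d n =
    (case n of 0 \<Rightarrow> {\<zero>\<^bsub>C 0\<^esub>} | Suc m \<Rightarrow> d m ` carrier (C m))"

definition cohomology ::
  "(nat \<Rightarrow> ('k, 'c) module) \<Rightarrow> (nat \<Rightarrow> 'c \<Rightarrow> 'c) \<Rightarrow> nat \<Rightarrow> ('k, 'c set) module"
  where "cohomology C d n =
    quotient_module ((C n)\<lparr>carrier := cocycles C d n\<rparr>) (coboundaries C d n)"

text \<open>The map that a morphism of complexes \<open>g\<close> into \<open>(C', d')\<close> induces in cohomology. A class is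
  a coset \<open>X\<close>; the cosets united on the right-hand side are all equal.\<close>

definition cohomology_map ::
  "(nat \<Rightarrow> ('k, 'c) module) \<Rightarrow> (nat \<Rightarrow> 'c \<Rightarrow> 'c) \<Rightarrow> (nat \<Rightarrow> 'b \<Rightarrow> 'c) \<Rightarrow> nat \<Rightarrow> 'b set \<Rightarrow> 'c set"
  where "cohomology_map C' d' g n X = (\<Union>x\<in>X. coboundaries C' d' n +>\<^bsub>C' n\<^esub> g n x)"


section \<open>Algebras, Hom complexes and Ext\<close>

locale assoc_algebra = module K A + A?: ring A for K (structure) and A (structure) +
  assumes smult_mult_left:
      "\<lbrakk>c \<in> carrier K; a \<in> carrier A; b \<in> carrier A\<rbrakk> \<Longrightarrow>
        (c \<odot>\<^bsub>A\<^esub> a) \<otimes>\<^bsub>A\<^esub> b = c \<odot>\<^bsub>A\<^esub> (a \<otimes>\<^bsub>A\<^esub> b)"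
    and smult_mult_right:
      "\<lbrakk>c \<in> carrier K; a \<in> carrier A; b \<in> carrier A\<rbrakk> \<Longrightarrow>
        a \<otimes>\<^bsub>A\<^esub> (c \<odot>\<^bsub>A\<^esub> b) = c \<odot>\<^bsub>A\<^esub> (a \<otimes>\<^bsub>A\<^esub> b)"

text \<open>The \<open>K\<close>-module underlying a left \<open>A\<close>-module.\<close>

definition base_module ::
  "('k, 'a) module \<Rightarrow> ('a, 'm) module \<Rightarrow> ('k, 'm) module"
  where "base_module A M =
    \<lparr>carrier = carrier M, mult = mult M, one = one M, zero = zero M, add = add M,
     smult = (\<lambda>c x. (c \<odot>\<^bsub>A\<^esub> \<one>\<^bsub>A\<^esub>) \<odot>\<^bsub>M\<^esub> x)\<rparr>"

text \<open>Homomorphisms are extensional functions, so that equality of homomorphisms is equality on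
  the carrier.\<close>

definition hom_module ::
  "('k, 'a) module \<Rightarrow> ('a, 'p) module \<Rightarrow> ('a, 'm) module \<Rightarrow> ('k, 'p \<Rightarrow> 'm) module"
  where "hom_module A P N =
    \<lparr>carrier = {\<phi> \<in> extensional (carrier P). linear_map A P N \<phi>},
     mult = undefined, one = undefined,
     zero = (\<lambda>p\<in>carrier P. \<zero>\<^bsub>N\<^esub>),
     add = (\<lambda>\<phi> \<psi>. \<lambda>p\<in>carrier P. \<phi> p \<oplus>\<^bsub>N\<^esub> \<psi> p),
     smult = (\<lambda>c \<phi>. \<lambda>p\<in>carrier P. c \<odot>\<^bsub>base_module A N\<^esub> \<phi> p)\<rparr>"

definition hom_complex ::
  "('k, 'a) module \<Rightarrow> (nat \<Rightarrow> ('a, 'p) module) \<Rightarrow> ('a, 'm) module \<Rightarrow> nat \<Rightarrow> ('k, 'p \<Rightarrow> 'm) module"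
  where "hom_complex A P N n = hom_module A (P n) N"

definition hom_diff ::
  "(nat \<Rightarrow> ('a, 'p) module) \<Rightarrow> (nat \<Rightarrow> 'p \<Rightarrow> 'p) \<Rightarrow> nat \<Rightarrow> ('p \<Rightarrow> 'm) \<Rightarrow> ('p \<Rightarrow> 'm)"
  where "hom_diff P d n \<phi> = (\<lambda>p\<in>carrier (P (Suc n)). \<phi> (d (Suc n) p))"

definition hom_cohomology ::
  "('k, 'a) module \<Rightarrow> (nat \<Rightarrow> ('a, 'p) module) \<Rightarrow> (nat \<Rightarrow> 'p \<Rightarrow> 'p) \<Rightarrow> ('a, 'm) module \<Rightarrow>
   nat \<Rightarrow> ('k, ('p \<Rightarrow> 'm) set) module"
  where "hom_cohomology A P d N = cohomology (hom_complex A P N) (hom_diff P d)"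

definition Ext ::
  "('k, 'a) module \<Rightarrow> ('a, 'm) module \<Rightarrow> ('a, 'n) module \<Rightarrow>
   nat \<Rightarrow> ('k, ((('a, 'm) label \<Rightarrow> 'a) \<Rightarrow> 'n) set) module"
  where "Ext A M N = hom_cohomology A (std_resolution A M) (\<lambda>_. std_diff A) N"

text \<open>The canonical isomorphism \<open>H\<^sup>n (Hom\<^sub>A (P, N)) \<rightarrow> Ext\<^sup>n (M, N)\<close> attached to a projective
  resolution \<open>P\<close> of \<open>M\<close>: precomposition with a comparison map from the standard resolution, the
  choice of which does not affect the map in cohomology.\<close>

definition Ext_iso ::
  "('k, 'a) module \<Rightarrow> ('a, 'm) module \<Rightarrow> ('a, 'n) module \<Rightarrow>
   (nat \<Rightarrow> ('a, 'p) module) \<Rightarrow> (nat \<Rightarrow> 'p \<Rightarrow> 'p) \<Rightarrow> ('p \<Rightarrow> 'm) \<Rightarrow>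
   nat \<Rightarrow> ('p \<Rightarrow> 'n) set \<Rightarrow> ((('a, 'm) label \<Rightarrow> 'a) \<Rightarrow> 'n) set"
  where "Ext_iso A M N P d \<epsilon> =
    (let \<alpha> = (SOME \<alpha>. comparison_map A
                 (std_resolution A M) (\<lambda>_. std_diff A) (std_aug A M) P d \<epsilon> \<alpha>)
     in cohomology_map (hom_complex A (std_resolution A M) N)
          (hom_diff (std_resolution A M) (\<lambda>_. std_diff A))
          (\<lambda>n \<phi>. \<lambda>u\<in>carrier (std_resolution A M n). \<phi> (\<alpha> n u)))"


section \<open>Operators over a derivation\<close>

definition linear_derivation ::
  "('k, 'x) ring_scheme \<Rightarrow> ('k, 'a) module \<Rightarrow> ('a \<Rightarrow> 'a) \<Rightarrow> bool"
  where "linear_derivation K A \<delta> \<longleftrightarrow> linear_map K A A \<delta> \<and>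
    (\<forall>a\<in>carrier A. \<forall>b\<in>carrier A. \<delta> (a \<otimes>\<^bsub>A\<^esub> b) = \<delta> a \<otimes>\<^bsub>A\<^esub> b \<oplus>\<^bsub>A\<^esub> a \<otimes>\<^bsub>A\<^esub> \<delta> b)"

definition delta_operator ::
  "('k, 'x) ring_scheme \<Rightarrow> ('k, 'a) module \<Rightarrow> ('a \<Rightarrow> 'a) \<Rightarrow> ('a, 'm) module \<Rightarrow> ('m \<Rightarrow> 'm) \<Rightarrow> bool"
  where "delta_operator K A \<delta> M f \<longleftrightarrow>
    linear_map K (base_module A M) (base_module A M) f \<and>
    (\<forall>a\<in>carrier A. \<forall>m\<in>carrier M. f (a \<odot>\<^bsub>M\<^esub> m) = \<delta> a \<odot>\<^bsub>M\<^esub> m \<oplus>\<^bsub>M\<^esub> a \<odot>\<^bsub>M\<^esub> f m)"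

definition delta_lifting ::
  "('k, 'x) ring_scheme \<Rightarrow> ('k, 'a) module \<Rightarrow> ('a \<Rightarrow> 'a) \<Rightarrow> ('m \<Rightarrow> 'm) \<Rightarrow>
   (nat \<Rightarrow> ('a, 'p) module) \<Rightarrow> (nat \<Rightarrow> 'p \<Rightarrow> 'p) \<Rightarrow> ('p \<Rightarrow> 'm) \<Rightarrow> (nat \<Rightarrow> 'p \<Rightarrow> 'p) \<Rightarrow> bool"
  where "delta_lifting K A \<delta> f P d \<epsilon> fs \<longleftrightarrow>
    (\<forall>i. delta_operator K A \<delta> (P i) (fs i)) \<and>
    (\<forall>p\<in>carrier (P 0). \<epsilon> (fs 0 p) = f (\<epsilon> p)) \<and>
    (\<forall>i. \<forall>p\<in>carrier (P (Suc i)). d (Suc i) (fs (Suc i) p) = fs i (d (Suc i) p))"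

definition sharp ::
  "('a, 'm) module \<Rightarrow> ('m \<Rightarrow> 'm) \<Rightarrow> (nat \<Rightarrow> ('a, 'p) module) \<Rightarrow> (nat \<Rightarrow> 'p \<Rightarrow> 'p) \<Rightarrow>
   nat \<Rightarrow> ('p \<Rightarrow> 'm) \<Rightarrow> ('p \<Rightarrow> 'm)"
  where "sharp M f P fs i \<phi> = (\<lambda>p\<in>carrier (P i). f (\<phi> p) \<ominus>\<^bsub>M\<^esub> \<phi> (fs i p))"

definition nabla_res ::
  "('k, 'a) module \<Rightarrow> ('a, 'm) module \<Rightarrow> ('m \<Rightarrow> 'm) \<Rightarrow>
   (nat \<Rightarrow> ('a, 'p) module) \<Rightarrow> (nat \<Rightarrow> 'p \<Rightarrow> 'p) \<Rightarrow> (nat \<Rightarrow> 'p \<Rightarrow> 'p) \<Rightarrow>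
   nat \<Rightarrow> ('p \<Rightarrow> 'm) set \<Rightarrow> ('p \<Rightarrow> 'm) set"
  where "nabla_res A M f P d fs =
    cohomology_map (hom_complex A P M) (hom_diff P d) (sharp M f P fs)"

text \<open>Commutativity, in all degrees, of the square with vertical arrows \<^const>\<open>Ext_iso\<close>, top arrow
  \<^const>\<open>nabla_res\<close> and bottom arrow \<open>D\<close>.\<close>

definition nabla_square ::
  "('k, 'a) module \<Rightarrow> ('a, 'm) module \<Rightarrow> ('m \<Rightarrow> 'm) \<Rightarrow>
   (nat \<Rightarrow> ((('a, 'm) label \<Rightarrow> 'a) \<Rightarrow> 'm) set \<Rightarrow> ((('a, 'm) label \<Rightarrow> 'a) \<Rightarrow> 'm) set) \<Rightarrow>
   (nat \<Rightarrow> ('a, 'p) module) \<Rightarrow> (nat \<Rightarrow> 'p \<Rightarrow> 'p) \<Rightarrow> ('p \<Rightarrow> 'm) \<Rightarrow> (nat \<Rightarrow> 'p \<Rightarrow> 'p) \<Rightarrow> bool"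
  where "nabla_square A M f D P d \<epsilon> fs \<longleftrightarrow>
    (\<forall>n. \<forall>x\<in>carrier (hom_cohomology A P d M n).
      Ext_iso A M M P d \<epsilon> n (nabla_res A M f P d fs n x) =
      D n (Ext_iso A M M P d \<epsilon> n x))"

end

theory Submission
  imports Defs
begin

text \<open>For \<open>\<delta>\<close>-operators \<open>g\<close> on \<open>P\<close> and \<open>f\<close> on \<open>Q\<close> and an \<open>A\<close>-linear \<open>h : P \<rightarrow> Q\<close>, the
  commutator \<open>f h - h g\<close> is \<open>A\<close>-linear. Hence, if \<open>\<alpha> : P \<rightarrow> Q\<close> is a comparison map of
  resolutions and \<open>g\<close>, \<open>f\<close> are \<open>\<delta>\<close>-liftings to \<open>P\<close>, \<open>Q\<close>, then \<open>f \<alpha> - \<alpha> g\<close> is a linear chain map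
  over \<open>0\<close>, so it is null-homotopic; the two ways around the square differ, on a cocycle \<open>\<phi>\<close>, by
  \<open>\<phi> (f \<alpha> - \<alpha> g)\<close>, a coboundary. The standard resolution has a \<open>\<delta>\<close>-lifting, which defines
  \<open>\<nabla>\<close> on Ext: applying \<open>\<delta>\<close> to coefficients is a \<open>\<delta>\<close>-operator on each free module, and by
  projectivity it can be corrected by a linear map to commute with the differentials. Uniqueness
  comes from the standard resolution itself.\<close>

section \<open>Additive and linear maps\<close>

lemma (in abelian_group) minus_eq_iff:
  "x \<in> carrier G \<Longrightarrow> y \<in> carrier G \<Longrightarrow> z \<in> carrier G \<Longrightarrow> x \<ominus> y = z \<longleftrightarrow> x = z \<oplus> y"
  by (auto simp: minus_eq a_assoc r_neg l_neg)

lemma (in abelian_group) add_minus_add: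
  "a \<in> carrier G \<Longrightarrow> b \<in> carrier G \<Longrightarrow> c \<in> carrier G \<Longrightarrow> e \<in> carrier G \<Longrightarrow>
    (a \<oplus> b) \<ominus> (c \<oplus> e) = (a \<ominus> c) \<oplus> (b \<ominus> e)"
  by (simp add: minus_eq minus_add a_ac)

text \<open>Serves the comparison of the two ways around the square, where \<open>a\<close> is the
  common term \<open>f (\<phi> (\<alpha> p))\<close>.\<close>

lemma (in abelian_group) minus_minus_cancel:
  assumes "a \<in> carrier G" "b \<in> carrier G" "c \<in> carrier G"
  shows "(a \<ominus> b) \<ominus> (a \<ominus> c) = c \<ominus> b"
proof -
  have "(a \<ominus> b) \<ominus> (a \<ominus> c) = (a \<ominus> a) \<oplus> (\<ominus> b \<ominus> \<ominus> c)"
    using add_minus_add[of a "\<ominus> b" a "\<ominus> c"] assms by (simp add: minus_eq)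
  then show ?thesis using assms by (simp add: minus_eq r_neg a_comm)
qed

text \<open>Only additivity is assumed, because one application is multiplication by a fixed ring
  element, which need not be linear over a noncommutative ring.\<close>

lemma additive_minus:
  assumes "abelian_group G" "abelian_group H" "h \<in> carrier G \<rightarrow> carrier H"
    and "\<And>x y. x \<in> carrier G \<Longrightarrow> y \<in> carrier G \<Longrightarrow> h (x \<oplus>\<^bsub>G\<^esub> y) = h x \<oplus>\<^bsub>H\<^esub> h y"
    and "x \<in> carrier G" "y \<in> carrier G"
  shows "h (x \<ominus>\<^bsub>G\<^esub> y) = h x \<ominus>\<^bsub>H\<^esub> h y"
proof -
  interpret G: abelian_group G by fact
  interpret H: abelian_group H by fact
  have "(x \<ominus>\<^bsub>G\<^esub> y) \<oplus>\<^bsub>G\<^esub> y = x"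
    using G.minus_eq_iff[of x y "x \<ominus>\<^bsub>G\<^esub> y"] assms(5,6) by simp
  then have "h x = h (x \<ominus>\<^bsub>G\<^esub> y) \<oplus>\<^bsub>H\<^esub> h y"
    using assms(4)[of "x \<ominus>\<^bsub>G\<^esub> y" y] assms(5,6) by simp
  then show ?thesis
    using H.minus_eq_iff[of "h x" "h y" "h (x \<ominus>\<^bsub>G\<^esub> y)"] assms(3,5,6) by (auto simp: Pi_iff)
qed

lemma left_moduleD:
  assumes "left_module R M"
  shows "ring R" "abelian_group M"
  using assms by (auto simp: left_module_def)

lemma linear_map_minus:
  assumes "linear_map R M N h" "left_module R M" "left_module R N"
    and "x \<in> carrier M" "y \<in> carrier M"
  shows "h (x \<ominus>\<^bsub>M\<^esub> y) = h x \<ominus>\<^bsub>N\<^esub> h y"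
  using assms by (intro additive_minus) (auto simp: left_moduleD linear_map_def)

lemma (in left_module) smult_minus:
  "a \<in> carrier R \<Longrightarrow> x \<in> carrier M \<Longrightarrow> y \<in> carrier M \<Longrightarrow>
    a \<odot>\<^bsub>M\<^esub> (x \<ominus>\<^bsub>M\<^esub> y) = a \<odot>\<^bsub>M\<^esub> x \<ominus>\<^bsub>M\<^esub> a \<odot>\<^bsub>M\<^esub> y"
  by (rule additive_minus[of M M "\<lambda>x. a \<odot>\<^bsub>M\<^esub> x"]) (auto simp: smult_r_distr M.abelian_group_axioms)

lemma linear_map_diff:
  assumes "linear_map R M N h" "linear_map R M N k" "left_module R N"
  shows "linear_map R M N (\<lambda>x. h x \<ominus>\<^bsub>N\<^esub> k x)"
proof -
  interpret N: left_module R N by fact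
  show ?thesis
    unfolding linear_map_def
    by (auto simp: linear_mapD[OF assms(1)] linear_mapD[OF assms(2)] N.M.add_minus_add N.smult_minus)
qed


section \<open>Cochain complexes\<close>

text \<open>The coset is formed in \<open>C n\<close>, whereas \<open>cohomology\<close> works in
  the submodule of cocycles; the two agree because a coset depends on the addition alone.\<close>

definition cohomology_class ::
  "(nat \<Rightarrow> ('k, 'c) module) \<Rightarrow> (nat \<Rightarrow> 'c \<Rightarrow> 'c) \<Rightarrow> nat \<Rightarrow> 'c \<Rightarrow> 'c set"
  where "cohomology_class C d n x = coboundaries C d n +>\<^bsub>C n\<^esub> x"

locale cochain_complex =
  fixes K :: "('k, 'x) ring_scheme" and C :: "nat \<Rightarrow> ('k, 'c) module" and d :: "nat \<Rightarrow> 'c \<Rightarrow> 'c"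
  assumes module: "left_module K (C n)"
    and diff: "linear_map K (C n) (C (Suc n)) (d n)"
    and diff_diff: "x \<in> carrier (C n) \<Longrightarrow> d (Suc n) (d n x) = \<zero>\<^bsub>C (Suc (Suc n))\<^esub>"
begin

section \<open>Cocycles and coboundaries as submodules\<close>

lemma cocycles_closed:
  assumes "x \<in> cocycles C d n"
  shows "x \<in> carrier (C n)"
    and "y \<in> cocycles C d n \<Longrightarrow> x \<oplus>\<^bsub>C n\<^esub> y \<in> cocycles C d n"
    and "a \<in> carrier K \<Longrightarrow> a \<odot>\<^bsub>C n\<^esub> x \<in> cocycles C d n"
proof -
  interpret C: left_module K "C n" by (rule module)
  interpret C': left_module K "C (Suc n)" by (rule module)
  show "x \<in> carrier (C n)"
    and "y \<in> cocycles C d n \<Longrightarrow> x \<oplus>\<^bsub>C n\<^esub> y \<in> cocycles C d n"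
    and "a \<in> carrier K \<Longrightarrow> a \<odot>\<^bsub>C n\<^esub> x \<in> cocycles C d n"
    using assms by (auto simp: cocycles_def linear_mapD[OF diff] C'.smult_r_null)
qed

lemma coboundaries_zero: "\<zero>\<^bsub>C n\<^esub> \<in> coboundaries C d n"
proof (cases n)
  case (Suc m)
  interpret C: left_module K "C m" by (rule module)
  show ?thesis
    using Suc linear_map_zero[OF diff module module, of m]
    by (auto simp: coboundaries_def intro!: image_eqI[of _ _ "\<zero>\<^bsub>C m\<^esub>"])
qed (simp add: coboundaries_def)

lemma coboundaries_cocycles: "coboundaries C d n \<subseteq> cocycles C d n"
proof (cases n)
  case 0
  interpret C: left_module K "C 0" by (rule module)
  show ?thesis
    using 0 linear_map_zero[OF diff module module, of 0]
    by (auto simp: coboundaries_def cocycles_def)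
next
  case (Suc m)
  then show ?thesis
    by (auto simp: coboundaries_def cocycles_def linear_mapD[OF diff] diff_diff)
qed

lemma coboundaries_minus:
  assumes "x \<in> coboundaries C d n" "y \<in> coboundaries C d n"
  shows "x \<ominus>\<^bsub>C n\<^esub> y \<in> coboundaries C d n"
proof (cases n)
  case 0
  interpret C: left_module K "C 0" by (rule module)
  show ?thesis using assms 0 by (auto simp: coboundaries_def C.M.minus_eq)
next
  case (Suc m)
  interpret C: left_module K "C m" by (rule module)
  obtain u v where uv: "u \<in> carrier (C m)" "v \<in> carrier (C m)" "x = d m u" "y = d m v"
    using assms Suc by (auto simp: coboundaries_def)
  have "d m (u \<ominus>\<^bsub>C m\<^esub> v) = x \<ominus>\<^bsub>C n\<^esub> y"
    using linear_map_minus[OF diff module module, of u m v] uv Suc by simp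
  then show ?thesis
    using uv Suc by (auto simp: coboundaries_def intro!: image_eqI[of _ _ "u \<ominus>\<^bsub>C m\<^esub> v"])
qed

lemma coboundaries_smult:
  assumes "a \<in> carrier K" "x \<in> coboundaries C d n"
  shows "a \<odot>\<^bsub>C n\<^esub> x \<in> coboundaries C d n"
proof (cases n)
  case 0
  interpret C: left_module K "C 0" by (rule module)
  show ?thesis using assms 0 by (auto simp: coboundaries_def C.smult_r_null)
next
  case (Suc m)
  interpret C: left_module K "C m" by (rule module)
  obtain u where u: "u \<in> carrier (C m)" "x = d m u"
    using assms Suc by (auto simp: coboundaries_def)
  then have "d m (a \<odot>\<^bsub>C m\<^esub> u) = a \<odot>\<^bsub>C n\<^esub> x"
    using linear_mapD(3)[OF diff assms(1), of u m] Suc by simp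
  then show ?thesis
    using u assms Suc by (auto simp: coboundaries_def intro!: image_eqI[of _ _ "a \<odot>\<^bsub>C m\<^esub> u"])
qed

lemma coboundaries_subgroup: "abelian_subgroup (coboundaries C d n) (C n)"
proof -
  interpret C: left_module K "C n" by (rule module)
  have sub: "coboundaries C d n \<subseteq> carrier (C n)"
    using coboundaries_cocycles cocycles_closed(1) by blast
  \<comment> \<open>Closure under differences yields negatives as \<open>0 - x\<close>, and then
    sums as \<open>x - (- y)\<close>.\<close>
  have neg: "\<ominus>\<^bsub>C n\<^esub> x \<in> coboundaries C d n" if "x \<in> coboundaries C d n" for x
    using coboundaries_minus[OF coboundaries_zero that] that sub by (auto simp: C.M.minus_eq)
  have "x \<oplus>\<^bsub>C n\<^esub> y \<in> coboundaries C d n"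
    if "x \<in> coboundaries C d n" "y \<in> coboundaries C d n" for x y
    using coboundaries_minus[OF that(1) neg[OF that(2)]] that sub
    by (auto simp: C.M.minus_eq subset_iff)
  with neg sub have "subgroup (coboundaries C d n) (add_monoid (C n))"
    by (intro subgroup.intro) (auto simp: coboundaries_zero simp flip: a_inv_def)
  then show ?thesis
    by (intro abelian_subgroupI3 additive_subgroup.intro) (auto simp: C.M.abelian_group_axioms)
qed

section \<open>Cohomology classes as cosets, and their module operations\<close>

lemma class_eq_iff:
  assumes "x \<in> carrier (C n)" "y \<in> carrier (C n)"
  shows "cohomology_class C d n x = cohomology_class C d n y \<longleftrightarrow>
    x \<ominus>\<^bsub>C n\<^esub> y \<in> coboundaries C d n"
proof -
  interpret B: abelian_subgroup "coboundaries C d n" "C n" by (rule coboundaries_subgroup)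
  have "x \<in> cohomology_class C d n y \<longleftrightarrow> x \<ominus>\<^bsub>C n\<^esub> y \<in> coboundaries C d n"
    using B.a_rcos_module[OF assms(2,1)] by (simp add: cohomology_class_def B.minus_eq)
  then show ?thesis
    using B.a_repr_independence'[of x y] B.a_rcos_self[of x] assms
    by (auto simp: cohomology_class_def)
qed

lemma class_memD:
  assumes "y \<in> cohomology_class C d n x" "x \<in> carrier (C n)"
  shows "y \<in> carrier (C n)" "y \<ominus>\<^bsub>C n\<^esub> x \<in> coboundaries C d n"
proof -
  interpret B: abelian_subgroup "coboundaries C d n" "C n" by (rule coboundaries_subgroup)
  show y: "y \<in> carrier (C n)"
    using assms B.a_subset B.a_r_coset_subset_G by (auto simp: cohomology_class_def)
  show "y \<ominus>\<^bsub>C n\<^esub> x \<in> coboundaries C d n"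
    using assms y B.a_rcos_module[of x y] by (simp add: cohomology_class_def B.minus_eq)
qed

lemma class_mem: "x \<in> carrier (C n) \<Longrightarrow> x \<in> cohomology_class C d n x"
  using abelian_subgroup.a_rcos_self[OF coboundaries_subgroup] by (simp add: cohomology_class_def)

lemma cohomology_carrier: "carrier (cohomology C d n) = cohomology_class C d n ` cocycles C d n"
  by (auto simp: cohomology_def quotient_module_def A_RCOSETS_def' cohomology_class_def a_r_coset_def')

lemma cohomology_add:
  assumes "x \<in> cocycles C d n" "y \<in> cocycles C d n"
  shows "cohomology_class C d n x \<oplus>\<^bsub>cohomology C d n\<^esub> cohomology_class C d n y =
    cohomology_class C d n (x \<oplus>\<^bsub>C n\<^esub> y)"
proof -
  interpret B: abelian_subgroup "coboundaries C d n" "C n" by (rule coboundaries_subgroup)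
  \<comment> \<open>Setwise addition does not refer to the carrier, so passing to the cocycles
    leaves it unchanged.\<close>
  have "X <+>\<^bsub>(C n)\<lparr>carrier := Z\<rparr>\<^esub> Y = X <+>\<^bsub>C n\<^esub> Y" for X Y Z
    by (simp add: set_add_def')
  then show ?thesis
    using B.a_rcos_sum assms cocycles_closed(1)
    by (simp add: cohomology_def quotient_module_def cohomology_class_def)
qed

text \<open>A scalar multiple of a class is a union of cosets, one for each member of the class;
  they coincide because coboundaries are stable under scalars.\<close>

lemma cohomology_smult:
  assumes "a \<in> carrier K" "x \<in> cocycles C d n"
  shows "a \<odot>\<^bsub>cohomology C d n\<^esub> cohomology_class C d n x = cohomology_class C d n (a \<odot>\<^bsub>C n\<^esub> x)"
proof -
  interpret C: left_module K "C n" by (rule module)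
  note x = cocycles_closed(1)[OF assms(2)]
  have "cohomology_class C d n (a \<odot>\<^bsub>C n\<^esub> y) = cohomology_class C d n (a \<odot>\<^bsub>C n\<^esub> x)"
    if y: "y \<in> cohomology_class C d n x" for y
    using class_memD[OF y x] coboundaries_smult[OF assms(1)] class_eq_iff assms(1) x
    by (simp flip: C.smult_minus)
  then have "(\<Union>y\<in>cohomology_class C d n x. cohomology_class C d n (a \<odot>\<^bsub>C n\<^esub> y)) =
      cohomology_class C d n (a \<odot>\<^bsub>C n\<^esub> x)"
    by (intro UN_constant_eq[OF class_mem[OF x]]) blast
  moreover have "a \<odot>\<^bsub>cohomology C d n\<^esub> cohomology_class C d n x =
      (\<Union>y\<in>cohomology_class C d n x. cohomology_class C d n (a \<odot>\<^bsub>C n\<^esub> y))"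
    by (simp add: cohomology_def quotient_module_def cohomology_class_def a_r_coset_def')
  ultimately show ?thesis by (rule trans[rotated])
qed

end

section \<open>Cochain maps and the maps they induce on cohomology\<close>

locale cochain_map =
  C: cochain_complex K C d + D: cochain_complex K D d'
  for K :: "('k, 'x) ring_scheme" and C :: "nat \<Rightarrow> ('k, 'c) module" and d
    and D :: "nat \<Rightarrow> ('k, 'e) module" and d' +
  fixes g :: "nat \<Rightarrow> 'c \<Rightarrow> 'e"
  assumes linear: "linear_map K (C n) (D n) (g n)"
    and commute: "x \<in> carrier (C n) \<Longrightarrow> d' n (g n x) = g (Suc n) (d n x)"
begin

lemma map_cocycle: "x \<in> cocycles C d n \<Longrightarrow> g n x \<in> cocycles D d' n"
  using linear_map_zero[OF linear C.module D.module, of "Suc n"]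
  by (auto simp: cocycles_def commute linear_mapD[OF linear])

lemma map_coboundary: "x \<in> coboundaries C d n \<Longrightarrow> g n x \<in> coboundaries D d' n"
proof (cases n)
  case 0
  then show "x \<in> coboundaries C d n \<Longrightarrow> g n x \<in> coboundaries D d' n"
    using linear_map_zero[OF linear C.module D.module, of 0] by (auto simp: coboundaries_def)
next
  case (Suc m)
  assume "x \<in> coboundaries C d n"
  then obtain u where "u \<in> carrier (C m)" "x = d m u" using Suc by (auto simp: coboundaries_def)
  then show "g n x \<in> coboundaries D d' n"
    using Suc commute[of u m] linear_mapD(1)[OF linear, of u m]
    by (auto simp: coboundaries_def intro!: image_eqI[of _ _ "g m u"])
qed

text \<open>Two representatives of a class differ by a coboundary, which \<open>g\<close> sends to a
  coboundary; hence all the cosets united in \<open>cohomology_map\<close> are the same.\<close>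

lemma cohomology_map_class:
  assumes "x \<in> cocycles C d n"
  shows "cohomology_map D d' g n (cohomology_class C d n x) = cohomology_class D d' n (g n x)"
proof -
  note x = C.cocycles_closed(1)[OF assms]
  have "cohomology_class D d' n (g n y) = cohomology_class D d' n (g n x)"
    if y: "y \<in> cohomology_class C d n x" for y
    using C.class_memD[OF y x] map_coboundary[of "y \<ominus>\<^bsub>C n\<^esub> x" n]
      linear_map_minus[OF linear C.module D.module, of y n x] x
    by (subst D.class_eq_iff) (simp_all add: linear_mapD[OF linear])
  then have "(\<Union>y\<in>cohomology_class C d n x. cohomology_class D d' n (g n y)) =
      cohomology_class D d' n (g n x)"
    by (intro UN_constant_eq[OF C.class_mem[OF x]]) blast
  then show ?thesis by (simp add: cohomology_map_def cohomology_class_def)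
qed

lemma cohomology_map_linear:
  "linear_map K (cohomology C d n) (cohomology D d' n) (cohomology_map D d' g n)"
  unfolding linear_map_def C.cohomology_carrier D.cohomology_carrier
  by (auto simp: cohomology_map_class C.cohomology_add C.cohomology_smult D.cohomology_add
      D.cohomology_smult C.cocycles_closed map_cocycle linear_mapD[OF linear])

end

text \<open>Being mutually inverse on cocycles up to coboundaries is enough, since a class sees its
  cocycle only modulo coboundaries; the inverse bijection is the one induced by
  \<open>h\<close>.\<close>

lemma cohomology_map_iso:
  assumes "cochain_map K C d D d' g" "cochain_map K D d' C d h"
    and hg: "\<And>n x. x \<in> cocycles C d n \<Longrightarrow> h n (g n x) \<ominus>\<^bsub>C n\<^esub> x \<in> coboundaries C d n"
    and gh: "\<And>n y. y \<in> cocycles D d' n \<Longrightarrow> g n (h n y) \<ominus>\<^bsub>D n\<^esub> y \<in> coboundaries D d' n"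
  shows "linear_iso K (cohomology C d n) (cohomology D d' n) (cohomology_map D d' g n)"
proof -
  interpret g: cochain_map K C d D d' g by fact
  interpret h: cochain_map K D d' C d h by fact
  have "bij_betw (cohomology_map D d' g n) (carrier (cohomology C d n)) (carrier (cohomology D d' n))"
  proof (rule bij_betwI[where g = "cohomology_map C d h n"])
    fix X assume "X \<in> carrier (cohomology C d n)"
    then show "cohomology_map C d h n (cohomology_map D d' g n X) = X"
      by (clarsimp simp: g.C.cohomology_carrier g.cohomology_map_class h.cohomology_map_class
          g.map_cocycle h.map_cocycle g.C.cocycles_closed(1)
          g.C.class_eq_iff hg)
  next
    fix Y assume "Y \<in> carrier (cohomology D d' n)"
    then show "cohomology_map D d' g n (cohomology_map C d h n Y) = Y"
      by (clarsimp simp: g.D.cohomology_carrier g.cohomology_map_class h.cohomology_map_class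
          g.map_cocycle h.map_cocycle g.D.cocycles_closed(1)
          g.D.class_eq_iff gh)
  qed (auto simp: linear_mapD[OF g.cohomology_map_linear] linear_mapD[OF h.cohomology_map_linear])
  then show ?thesis by (simp add: linear_iso_def g.cohomology_map_linear)
qed


section \<open>Lifting along projective resolutions\<close>

text \<open>Cutting the target down to the image makes \<open>h\<close> surjective, as the lifting
  property of projective modules demands.\<close>

lemma image_left_module:
  assumes "left_module R Q" "left_module R N" "linear_map R Q N h"
  shows "left_module R (N\<lparr>carrier := h ` carrier Q\<rparr>)"
proof -
  interpret Q: left_module R Q by fact
  interpret N: left_module R N by fact
  note h = linear_mapD[OF assms(3)]
  have zero: "\<zero>\<^bsub>N\<^esub> \<in> h ` carrier Q"
    using linear_map_zero[OF assms(3,1,2)] by (metis Q.M.zero_closed image_eqI)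
  have neg: "\<exists>y\<in>carrier Q. h y \<oplus>\<^bsub>N\<^esub> h x = \<zero>\<^bsub>N\<^esub>" if "x \<in> carrier Q" for x
    using that h(2)[of "\<ominus>\<^bsub>Q\<^esub> x" x] linear_map_zero[OF assms(3,1,2)]
    by (intro bexI[of _ "\<ominus>\<^bsub>Q\<^esub> x"]) (auto simp: Q.M.l_neg)
  have "abelian_group (N\<lparr>carrier := h ` carrier Q\<rparr>)"
  proof (rule abelian_groupI)
    fix x y
    assume "x \<in> carrier (N\<lparr>carrier := h ` carrier Q\<rparr>)" "y \<in> carrier (N\<lparr>carrier := h ` carrier Q\<rparr>)"
    then show "x \<oplus>\<^bsub>N\<lparr>carrier := h ` carrier Q\<rparr>\<^esub> y \<in> carrier (N\<lparr>carrier := h ` carrier Q\<rparr>)"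
      by (auto simp flip: h(2))
  qed (use zero neg h(1) in \<open>auto simp: N.M.a_ac\<close>)
  then show ?thesis
    using h(1)
    by (intro left_module.intro left_module_axioms.intro Q.R.ring_axioms)
       (auto simp: N.smult_l_distr N.smult_r_distr N.smult_assoc Q.smult_l_distr Q.smult_assoc h(2)
         simp flip: h(3))
qed

text \<open>The form in which projectivity meets exactness: values of \<open>k\<close> killed by the
  next differential lie in the image of \<open>h\<close>, and over that image they can be
  lifted.\<close>

lemma projective_lift_image:
  assumes "projective_module R P" "left_module R Q" "left_module R N" "linear_map R Q N h"
    and "linear_map R P N k" "\<And>p. p \<in> carrier P \<Longrightarrow> k p \<in> h ` carrier Q"
  shows "\<exists>l. linear_map R P Q l \<and> (\<forall>p\<in>carrier P. h (l p) = k p)"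
  using assms(5,6) linear_mapD(2,3)[OF assms(4)]
  by (intro projective_module_lift[OF assms(1,2) image_left_module[OF assms(2-4)]])
     (auto simp: linear_map_def)

text \<open>Exactness is extracted in two forms: facts 6 and 7 certify that an element has a
  preimage, as \<open>projective_lift_image\<close> requires, while facts 8 and 9 rewrite composites
  of consecutive maps to zero.\<close>

lemma projective_resolutionD:
  assumes "projective_resolution R M P d \<epsilon>"
  shows "projective_module R (P i)" "left_module R (P i)"
    and "linear_map R (P 0) M \<epsilon>" "linear_map R (P (Suc i)) (P i) (d (Suc i))"
    and "\<epsilon> ` carrier (P 0) = carrier M"
    and "p \<in> carrier (P 0) \<Longrightarrow> p \<in> d (Suc 0) ` carrier (P (Suc 0)) \<longleftrightarrow> \<epsilon> p = \<zero>\<^bsub>M\<^esub>"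
    and "q \<in> carrier (P (Suc i)) \<Longrightarrow>
      q \<in> d (Suc (Suc i)) ` carrier (P (Suc (Suc i))) \<longleftrightarrow> d (Suc i) q = \<zero>\<^bsub>P i\<^esub>"
    and "p \<in> carrier (P (Suc 0)) \<Longrightarrow> \<epsilon> (d (Suc 0) p) = \<zero>\<^bsub>M\<^esub>"
    and "q \<in> carrier (P (Suc (Suc i))) \<Longrightarrow> d (Suc i) (d (Suc (Suc i)) q) = \<zero>\<^bsub>P i\<^esub>"
proof -
  show proj: "projective_module R (P i)" for i
    using assms by (simp add: projective_resolution_def)
  then show "left_module R (P i)" by (simp add: projective_module_def)
  have ker: "d (Suc 0) ` carrier (P (Suc 0)) = {p \<in> carrier (P 0). \<epsilon> p = \<zero>\<^bsub>M\<^esub>}"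
    "d (Suc (Suc i)) ` carrier (P (Suc (Suc i))) =
      {p \<in> carrier (P (Suc i)). d (Suc i) p = \<zero>\<^bsub>P i\<^esub>}"
    using assms by (auto simp: projective_resolution_def)
  show "p \<in> carrier (P 0) \<Longrightarrow> p \<in> d (Suc 0) ` carrier (P (Suc 0)) \<longleftrightarrow> \<epsilon> p = \<zero>\<^bsub>M\<^esub>"
    and "q \<in> carrier (P (Suc i)) \<Longrightarrow>
      q \<in> d (Suc (Suc i)) ` carrier (P (Suc (Suc i))) \<longleftrightarrow> d (Suc i) q = \<zero>\<^bsub>P i\<^esub>"
    unfolding ker by auto
  show "p \<in> carrier (P (Suc 0)) \<Longrightarrow> \<epsilon> (d (Suc 0) p) = \<zero>\<^bsub>M\<^esub>"
    and "q \<in> carrier (P (Suc (Suc i))) \<Longrightarrow> d (Suc i) (d (Suc (Suc i)) q) = \<zero>\<^bsub>P i\<^esub>"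
    using ker by blast+
qed (use assms in \<open>auto simp: projective_resolution_def\<close>)

lemma comparison_map_exists:
  assumes M: "left_module R M"
    and P: "projective_resolution R M P d \<epsilon>" and Q: "projective_resolution R M Q d' \<epsilon>'"
  shows "\<exists>\<alpha>. comparison_map R P d \<epsilon> Q d' \<epsilon>' \<alpha>"
proof -
  note PD = projective_resolutionD[OF P] and QD = projective_resolutionD[OF Q]
  \<comment> \<open>The invariant of a recursive choice. Its last conjunct says that the next
    component can be lifted; the augmentation constrains degree 0 only, where there is no earlier
    component.\<close>
  let ?good = "\<lambda>n a. linear_map R (P n) (Q n) a \<and> (n = 0 \<longrightarrow> (\<forall>p\<in>carrier (P 0). \<epsilon>' (a p) = \<epsilon> p)) \<and>
    (\<forall>p\<in>carrier (P (Suc n)). a (d (Suc n) p) \<in> d' (Suc n) ` carrier (Q (Suc n)))"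
  have "\<exists>\<alpha>. \<forall>n. ?good n (\<alpha> n) \<and>
    (\<forall>p\<in>carrier (P (Suc n)). d' (Suc n) (\<alpha> (Suc n) p) = \<alpha> n (d (Suc n) p))"
  proof (rule dependent_nat_choice)
    have "\<exists>a. linear_map R (P 0) (Q 0) a \<and> (\<forall>p\<in>carrier (P 0). \<epsilon>' (a p) = \<epsilon> p)"
      using linear_mapD(1)[OF PD(3)] QD(5)
      by (intro projective_lift_image[OF PD(1) QD(2) M QD(3) PD(3)]) auto
    then obtain a where a: "linear_map R (P 0) (Q 0) a" "\<forall>p\<in>carrier (P 0). \<epsilon>' (a p) = \<epsilon> p"
      by auto
    then have "?good 0 a"
      using linear_mapD(1)[OF a(1)] linear_mapD(1)[OF PD(4)] by (simp add: QD(6) PD(8))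
    then show "\<exists>a. ?good 0 a" by blast
  next
    fix a n assume a: "?good n a"
    have "\<exists>b. linear_map R (P (Suc n)) (Q (Suc n)) b \<and>
        (\<forall>p\<in>carrier (P (Suc n)). d' (Suc n) (b p) = a (d (Suc n) p))"
      using a linear_map_comp[OF PD(4)]
      by (intro projective_lift_image[OF PD(1) QD(2) QD(2) QD(4)]) auto
    then obtain b where b: "linear_map R (P (Suc n)) (Q (Suc n)) b"
      "\<And>p. p \<in> carrier (P (Suc n)) \<Longrightarrow> d' (Suc n) (b p) = a (d (Suc n) p)" by auto
    \<comment> \<open>By exactness it suffices that the differential kills this element:
      \<open>d' (b (d p)) = a (d (d p)) = a 0 = 0\<close>.\<close>
    then have "b (d (Suc (Suc n)) p) \<in> d' (Suc (Suc n)) ` carrier (Q (Suc (Suc n)))"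
      if "p \<in> carrier (P (Suc (Suc n)))" for p
      using that a linear_mapD(1)[OF b(1)] linear_mapD(1)[OF PD(4)]
        linear_map_zero[OF _ PD(2) QD(2), of n n a]
      by (simp add: QD(7) PD(9))
    then show "\<exists>b. ?good (Suc n) b \<and> (\<forall>p\<in>carrier (P (Suc n)). d' (Suc n) (b p) = a (d (Suc n) p))"
      using b by (intro exI[of _ b]) auto
  qed
  then show ?thesis unfolding comparison_map_def by metis
qed

text \<open>The usual relation \<open>h = d' s + s d\<close> is solved for \<open>d' s\<close>,
  because \<open>s\<close> is found degree by degree by lifting \<open>h - s d\<close> along
  \<open>d'\<close>.\<close>

lemma null_homotopy_exists:
  assumes P: "projective_resolution R M P d \<epsilon>" and Q: "projective_resolution R M Q d' \<epsilon>'"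
    and lin: "\<And>n. linear_map R (P n) (Q n) (h n)"
    and aug: "\<And>p. p \<in> carrier (P 0) \<Longrightarrow> \<epsilon>' (h 0 p) = \<zero>\<^bsub>M\<^esub>"
    and chain: "\<And>n p. p \<in> carrier (P (Suc n)) \<Longrightarrow> d' (Suc n) (h (Suc n) p) = h n (d (Suc n) p)"
  shows "\<exists>s. (\<forall>n. linear_map R (P n) (Q (Suc n)) (s n)) \<and>
    (\<forall>p\<in>carrier (P 0). d' (Suc 0) (s 0 p) = h 0 p) \<and>
    (\<forall>n. \<forall>p\<in>carrier (P (Suc n)).
      d' (Suc (Suc n)) (s (Suc n) p) = h (Suc n) p \<ominus>\<^bsub>Q (Suc n)\<^esub> s n (d (Suc n) p))"
proof -
  note PD = projective_resolutionD[OF P] and QD = projective_resolutionD[OF Q]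
  \<comment> \<open>The last conjunct is the homotopy relation on boundaries, where the term
    \<open>s d\<close> vanishes. It ensures that in the next degree \<open>h - s d\<close> takes its
    values in cycles.\<close>
  let ?good = "\<lambda>n a. linear_map R (P n) (Q (Suc n)) a \<and>
    (n = 0 \<longrightarrow> (\<forall>p\<in>carrier (P 0). d' (Suc 0) (a p) = h 0 p)) \<and>
    (\<forall>p\<in>carrier (P (Suc n)). d' (Suc n) (a (d (Suc n) p)) = h n (d (Suc n) p))"
  have "\<exists>s. \<forall>n. ?good n (s n) \<and> (\<forall>p\<in>carrier (P (Suc n)).
      d' (Suc (Suc n)) (s (Suc n) p) = h (Suc n) p \<ominus>\<^bsub>Q (Suc n)\<^esub> s n (d (Suc n) p))"
  proof (rule dependent_nat_choice)
    have "\<exists>a. linear_map R (P 0) (Q (Suc 0)) a \<and> (\<forall>p\<in>carrier (P 0). d' (Suc 0) (a p) = h 0 p)"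
      using linear_mapD(1)[OF lin]
      by (intro projective_lift_image[OF PD(1) QD(2) QD(2) QD(4) lin]) (auto simp: QD(6) aug)
    then show "\<exists>a. ?good 0 a" using linear_mapD(1)[OF PD(4)] by auto
  next
    fix a n assume a: "?good n a"
    interpret Qn: left_module R "Q n" by (rule QD(2))
    interpret Qn': left_module R "Q (Suc n)" by (rule QD(2))
    let ?k = "\<lambda>p. h (Suc n) p \<ominus>\<^bsub>Q (Suc n)\<^esub> a (d (Suc n) p)"
    have lk: "linear_map R (P (Suc n)) (Q (Suc n)) ?k"
      using a by (intro linear_map_diff lin linear_map_comp[OF PD(4)] QD(2)) auto
    \<comment> \<open>Both terms become \<open>h n (d p)\<close>: the first because \<open>h\<close>
      is a chain map, the second by the invariant.\<close>
    have dk: "d' (Suc n) (?k p) = \<zero>\<^bsub>Q n\<^esub>" if p: "p \<in> carrier (P (Suc n))" for p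
    proof -
      have "d' (Suc n) (?k p) = d' (Suc n) (h (Suc n) p) \<ominus>\<^bsub>Q n\<^esub> d' (Suc n) (a (d (Suc n) p))"
        using a p linear_mapD(1)[OF lin] linear_mapD(1)[OF PD(4)]
        by (intro linear_map_minus[OF QD(4) QD(2) QD(2)]) (auto simp: linear_map_def Pi_iff)
      also have "\<dots> = \<zero>\<^bsub>Q n\<^esub>"
        using a p linear_mapD(1)[OF lin[of n]] linear_mapD(1)[OF PD(4)]
        by (simp add: chain Qn.M.minus_eq Qn.M.r_neg)
      finally show ?thesis .
    qed
    have "\<exists>b. linear_map R (P (Suc n)) (Q (Suc (Suc n))) b \<and>
        (\<forall>p\<in>carrier (P (Suc n)). d' (Suc (Suc n)) (b p) = ?k p)"
      by (intro projective_lift_image[OF PD(1) QD(2) QD(2) QD(4) lk])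
         (simp add: QD(7) linear_mapD(1)[OF lk] dk)
    then obtain b where b: "linear_map R (P (Suc n)) (Q (Suc (Suc n))) b"
      "\<And>p. p \<in> carrier (P (Suc n)) \<Longrightarrow> d' (Suc (Suc n)) (b p) = ?k p" by auto
    \<comment> \<open>The choice of \<open>b\<close> leaves the extra term
      \<open>a (d (d p))\<close>, which is zero.\<close>
    have "d' (Suc (Suc n)) (b (d (Suc (Suc n)) p)) = h (Suc n) (d (Suc (Suc n)) p)"
      if p: "p \<in> carrier (P (Suc (Suc n)))" for p
      using p a b(2) linear_mapD(1)[OF lin[of "Suc n"]] linear_mapD(1)[OF PD(4)]
        linear_map_zero[OF _ PD(2) QD(2), of n "Suc n" a]
      by (simp add: PD(9) Qn'.M.minus_eq)
    then show "\<exists>b. ?good (Suc n) b \<and> (\<forall>p\<in>carrier (P (Suc n)). d' (Suc (Suc n)) (b p) = ?k p)"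
      using b by (intro exI[of _ b]) auto
  qed
  then obtain s where "\<And>n. ?good n (s n) \<and> (\<forall>p\<in>carrier (P (Suc n)).
      d' (Suc (Suc n)) (s (Suc n) p) = h (Suc n) p \<ominus>\<^bsub>Q (Suc n)\<^esub> s n (d (Suc n) p))" by auto
  then show ?thesis by (intro exI[of _ s]) auto
qed


section \<open>Hom complexes\<close>

lemma assoc_algebraD:
  assumes "assoc_algebra K A"
  shows "ring K" "ring A"
  using assms by (auto simp: assoc_algebra_def module_def cring_def)

lemma base_module_simps [simp]:
  "carrier (base_module A N) = carrier N" "\<zero>\<^bsub>base_module A N\<^esub> = \<zero>\<^bsub>N\<^esub>"
  "x \<oplus>\<^bsub>base_module A N\<^esub> y = x \<oplus>\<^bsub>N\<^esub> y"
  "c \<odot>\<^bsub>base_module A N\<^esub> x = (c \<odot>\<^bsub>A\<^esub> \<one>\<^bsub>A\<^esub>) \<odot>\<^bsub>N\<^esub> x"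
  by (simp_all add: base_module_def)

text \<open>Scalars land in the center of \<open>A\<close>; this is why the action of
  \<open>K\<close> on a \<open>base_module\<close> commutes with the action of
  \<open>A\<close>.\<close>

lemma (in assoc_algebra) scalar_mult:
  assumes "c \<in> carrier K" "a \<in> carrier A"
  shows "(c \<odot>\<^bsub>A\<^esub> \<one>\<^bsub>A\<^esub>) \<otimes>\<^bsub>A\<^esub> a = c \<odot>\<^bsub>A\<^esub> a" "a \<otimes>\<^bsub>A\<^esub> (c \<odot>\<^bsub>A\<^esub> \<one>\<^bsub>A\<^esub>) = c \<odot>\<^bsub>A\<^esub> a"
  using assms smult_mult_left[of c "\<one>\<^bsub>A\<^esub>" a] smult_mult_right[of c a "\<one>\<^bsub>A\<^esub>"] by auto

lemma base_module_left_module: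
  assumes "assoc_algebra K A" "left_module A N"
  shows "left_module K (base_module A N)"
proof -
  interpret A: assoc_algebra K A by fact
  interpret N: left_module A N by fact
  have "abelian_group (base_module A N)"
    by (rule abelian_groupI)
       (auto simp: N.M.a_ac intro: bexI[where P = "\<lambda>y. y \<oplus>\<^bsub>N\<^esub> x = \<zero>\<^bsub>N\<^esub>" for x, OF N.M.l_neg])
  moreover have "(a \<otimes>\<^bsub>K\<^esub> b) \<odot>\<^bsub>A\<^esub> \<one>\<^bsub>A\<^esub> = (a \<odot>\<^bsub>A\<^esub> \<one>\<^bsub>A\<^esub>) \<otimes>\<^bsub>A\<^esub> (b \<odot>\<^bsub>A\<^esub> \<one>\<^bsub>A\<^esub>)"
    if "a \<in> carrier K" "b \<in> carrier K" for a b
    using that by (simp add: A.smult_assoc1 A.scalar_mult(1))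
  ultimately show ?thesis
    by (intro left_module.intro left_module_axioms.intro assoc_algebraD[OF assms(1)])
       (auto simp: A.smult_l_distr N.smult_l_distr N.smult_r_distr N.smult_assoc)
qed

lemma hom_module_simps [simp]:
  "\<phi> \<in> carrier (hom_module A P N) \<longleftrightarrow> \<phi> \<in> extensional (carrier P) \<and> linear_map A P N \<phi>"
  "\<zero>\<^bsub>hom_module A P N\<^esub> = (\<lambda>p\<in>carrier P. \<zero>\<^bsub>N\<^esub>)"
  "\<phi> \<oplus>\<^bsub>hom_module A P N\<^esub> \<psi> = (\<lambda>p\<in>carrier P. \<phi> p \<oplus>\<^bsub>N\<^esub> \<psi> p)"
  "c \<odot>\<^bsub>hom_module A P N\<^esub> \<phi> = (\<lambda>p\<in>carrier P. (c \<odot>\<^bsub>A\<^esub> \<one>\<^bsub>A\<^esub>) \<odot>\<^bsub>N\<^esub> \<phi> p)"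
  by (simp_all add: hom_module_def)

lemma hom_module_closed:
  assumes A: "assoc_algebra K A" and P: "left_module A P" and N: "left_module A N"
  shows "\<zero>\<^bsub>hom_module A P N\<^esub> \<in> carrier (hom_module A P N)"
    and "\<phi> \<in> carrier (hom_module A P N) \<Longrightarrow> \<psi> \<in> carrier (hom_module A P N) \<Longrightarrow>
      \<phi> \<oplus>\<^bsub>hom_module A P N\<^esub> \<psi> \<in> carrier (hom_module A P N)"
    and "c \<in> carrier K \<Longrightarrow> \<phi> \<in> carrier (hom_module A P N) \<Longrightarrow>
      c \<odot>\<^bsub>hom_module A P N\<^esub> \<phi> \<in> carrier (hom_module A P N)"
proof -
  interpret A: assoc_algebra K A by fact
  interpret P: left_module A P by fact
  interpret N: left_module A N by fact
  show "\<zero>\<^bsub>hom_module A P N\<^esub> \<in> carrier (hom_module A P N)"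
    by (auto simp: linear_map_def N.smult_r_null)
  show "\<phi> \<oplus>\<^bsub>hom_module A P N\<^esub> \<psi> \<in> carrier (hom_module A P N)"
    if "\<phi> \<in> carrier (hom_module A P N)" "\<psi> \<in> carrier (hom_module A P N)"
  proof -
    have "linear_map A P N \<phi>" "linear_map A P N \<psi>" using that by auto
    then show ?thesis
      by (auto simp: linear_map_def Pi_iff N.smult_r_distr N.M.a_ac)
  qed
  show "c \<odot>\<^bsub>hom_module A P N\<^esub> \<phi> \<in> carrier (hom_module A P N)"
    if "c \<in> carrier K" "\<phi> \<in> carrier (hom_module A P N)"
  proof -
    have "linear_map A P N \<phi>" using that by auto
    \<comment> \<open>Linearity over \<open>A\<close> of a scalar multiple rests on the centrality
      of scalars in \<open>A\<close>.\<close>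
    then show ?thesis
      using that(1)
      by (auto simp: linear_map_def Pi_iff N.smult_r_distr A.scalar_mult simp flip: N.smult_assoc)
  qed
qed

lemma hom_module_left_module:
  assumes A: "assoc_algebra K A" and P: "left_module A P" and N: "left_module A N"
  shows "left_module K (hom_module A P N)"
proof -
  interpret A: assoc_algebra K A by fact
  interpret P: left_module A P by fact
  interpret N: left_module A N by fact
  interpret NK: left_module K "base_module A N" by (rule base_module_left_module[OF A N])
  note closed = hom_module_closed[OF A P N]
  have val: "\<phi> p \<in> carrier N" if "\<phi> \<in> carrier (hom_module A P N)" "p \<in> carrier P" for \<phi> p
    using that by (auto simp: linear_map_def)
  \<comment> \<open>This turns each module axiom into an identity between values in
    \<open>N\<close>; the axioms involving scalars then come from
    \<open>base_module A N\<close>.\<close>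
  have ext: "\<phi> = \<psi>"
    if "\<phi> \<in> carrier (hom_module A P N)" "\<psi> \<in> carrier (hom_module A P N)"
      "\<And>p. p \<in> carrier P \<Longrightarrow> \<phi> p = \<psi> p" for \<phi> \<psi>
    using that by (auto intro: extensionalityI)
  note simps = hom_module_simps(2-4) restrict_apply' val
  have "abelian_group (hom_module A P N)"
  proof (rule abelian_groupI)
    fix \<phi> assume \<phi>: "\<phi> \<in> carrier (hom_module A P N)"
    \<comment> \<open>The additive inverse, written as a difference so that
      \<open>linear_map_diff\<close> gives its linearity.\<close>
    let ?\<psi> = "\<lambda>p\<in>carrier P. \<zero>\<^bsub>N\<^esub> \<ominus>\<^bsub>N\<^esub> \<phi> p"
    have "linear_map A P N (\<lambda>p. \<zero>\<^bsub>N\<^esub> \<ominus>\<^bsub>N\<^esub> \<phi> p)"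
      using \<phi> by (intro linear_map_diff N) (auto simp: linear_map_def N.smult_r_null)
    then have \<psi>: "?\<psi> \<in> carrier (hom_module A P N)"
      by (auto intro: linear_map_cong[OF _ P])
    moreover have "?\<psi> \<oplus>\<^bsub>hom_module A P N\<^esub> \<phi> = \<zero>\<^bsub>hom_module A P N\<^esub>"
      using val[OF \<phi>] by (auto simp: N.M.minus_eq N.M.l_neg)
    ultimately show
      "\<exists>\<psi>\<in>carrier (hom_module A P N). \<psi> \<oplus>\<^bsub>hom_module A P N\<^esub> \<phi> = \<zero>\<^bsub>hom_module A P N\<^esub>"
      by blast
  next
    fix \<phi> \<psi> \<theta> assume "\<phi> \<in> carrier (hom_module A P N)" "\<psi> \<in> carrier (hom_module A P N)"
      "\<theta> \<in> carrier (hom_module A P N)"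
    then show "\<phi> \<oplus>\<^bsub>hom_module A P N\<^esub> \<psi> \<oplus>\<^bsub>hom_module A P N\<^esub> \<theta> =
        \<phi> \<oplus>\<^bsub>hom_module A P N\<^esub> (\<psi> \<oplus>\<^bsub>hom_module A P N\<^esub> \<theta>)"
      by (intro ext closed) (simp_all only: simps N.M.a_assoc)
  next
    fix \<phi> \<psi> assume "\<phi> \<in> carrier (hom_module A P N)" "\<psi> \<in> carrier (hom_module A P N)"
    then show "\<phi> \<oplus>\<^bsub>hom_module A P N\<^esub> \<psi> = \<psi> \<oplus>\<^bsub>hom_module A P N\<^esub> \<phi>"
      by (intro ext closed) (simp_all only: simps N.M.a_comm)
  next
    fix \<phi> assume "\<phi> \<in> carrier (hom_module A P N)"
    then show "\<zero>\<^bsub>hom_module A P N\<^esub> \<oplus>\<^bsub>hom_module A P N\<^esub> \<phi> = \<phi>"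
      by (intro ext closed) (simp_all only: simps N.M.l_zero)
  qed (fact closed)+
  then show ?thesis
  proof (intro left_module.intro left_module_axioms.intro assoc_algebraD[OF A])
    fix a b \<phi> assume "a \<in> carrier K" "b \<in> carrier K" "\<phi> \<in> carrier (hom_module A P N)"
    then show "(a \<oplus>\<^bsub>K\<^esub> b) \<odot>\<^bsub>hom_module A P N\<^esub> \<phi> =
        a \<odot>\<^bsub>hom_module A P N\<^esub> \<phi> \<oplus>\<^bsub>hom_module A P N\<^esub> b \<odot>\<^bsub>hom_module A P N\<^esub> \<phi>"
      and "(a \<otimes>\<^bsub>K\<^esub> b) \<odot>\<^bsub>hom_module A P N\<^esub> \<phi> =
        a \<odot>\<^bsub>hom_module A P N\<^esub> (b \<odot>\<^bsub>hom_module A P N\<^esub> \<phi>)"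
      using NK.smult_l_distr[of a b] NK.smult_assoc[of a b]
      by (intro ext closed; simp only: simps base_module_simps 
        A.R.a_closed A.R.m_closed)+
  next
    fix a \<phi> \<psi> assume "a \<in> carrier K" "\<phi> \<in> carrier (hom_module A P N)"
      "\<psi> \<in> carrier (hom_module A P N)"
    then show "a \<odot>\<^bsub>hom_module A P N\<^esub> (\<phi> \<oplus>\<^bsub>hom_module A P N\<^esub> \<psi>) =
        a \<odot>\<^bsub>hom_module A P N\<^esub> \<phi> \<oplus>\<^bsub>hom_module A P N\<^esub> a \<odot>\<^bsub>hom_module A P N\<^esub> \<psi>"
      using NK.smult_r_distr[of a]
      by (intro ext closed; simp only: simps base_module_simps)+
  next
    fix \<phi> assume "\<phi> \<in> carrier (hom_module A P N)"
    then show "\<one>\<^bsub>K\<^esub> \<odot>\<^bsub>hom_module A P N\<^esub> \<phi> = \<phi>"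
      using NK.smult_one
      by (intro ext closed; simp only: simps base_module_simps A.R.one_closed)+
  qed (assumption | rule closed)+
qed

text \<open>Subtraction is no component of the record but is derived from addition, so it is
  identified by checking \<open>\<theta> + \<psi> = \<phi>\<close> pointwise.\<close>

lemma hom_module_minus:
  assumes A: "assoc_algebra K A" and P: "left_module A P" and N: "left_module A N"
    and \<phi>: "\<phi> \<in> carrier (hom_module A P N)" and \<psi>: "\<psi> \<in> carrier (hom_module A P N)"
  shows "\<phi> \<ominus>\<^bsub>hom_module A P N\<^esub> \<psi> = (\<lambda>p\<in>carrier P. \<phi> p \<ominus>\<^bsub>N\<^esub> \<psi> p)"
proof -
  interpret H: left_module K "hom_module A P N" by (rule hom_module_left_module[OF A P N])
  interpret N: left_module A N by fact
  have lin: "linear_map A P N \<phi>" "linear_map A P N \<psi>" using \<phi> \<psi> by auto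
  let ?\<theta> = "\<lambda>p\<in>carrier P. \<phi> p \<ominus>\<^bsub>N\<^esub> \<psi> p"
  have "linear_map A P N ?\<theta>" by (rule linear_map_cong[OF linear_map_diff[OF lin N] P]) simp
  then have \<theta>: "?\<theta> \<in> carrier (hom_module A P N)" by simp
  have "\<phi> p = ?\<theta> p \<oplus>\<^bsub>N\<^esub> \<psi> p" if "p \<in> carrier P" for p
    using that N.M.minus_eq_iff[of "\<phi> p" "\<psi> p" "?\<theta> p"] linear_mapD(1)[OF lin(1)]
      linear_mapD(1)[OF lin(2)] by simp
  then have "\<phi> = ?\<theta> \<oplus>\<^bsub>hom_module A P N\<^esub> \<psi>"
    using \<phi> by (intro extensionalityI[of \<phi> "carrier P"]) auto
  then show ?thesis using H.M.minus_eq_iff[OF \<phi> \<psi> \<theta>] by simp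
qed

lemma hom_cochain_complex:
  fixes N :: "('a, 'n) module" and P :: "nat \<Rightarrow> ('a, 'p) module"
  assumes A: "assoc_algebra K A" and N: "left_module A N" and P: "projective_resolution A M P d \<epsilon>"
  shows "cochain_complex K (hom_complex A P N) (hom_diff P d)"
proof (rule cochain_complex.intro)
  note PD = projective_resolutionD[OF P]
  show "left_module K (hom_complex A P N n)" for n
    unfolding hom_complex_def by (rule hom_module_left_module[OF A PD(2) N])
  interpret N: left_module A N by fact
  show "linear_map K (hom_complex A P N n) (hom_complex A P N (Suc n)) (hom_diff P d n)" for n
  proof -
    interpret P: left_module A "P (Suc n)" by (rule PD(2))
    have "linear_map A (P (Suc n)) N (hom_diff P d n \<phi>)"
      if "linear_map A (P n) N \<phi>" for \<phi> :: "'p \<Rightarrow> 'n"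
      using linear_map_cong[OF linear_map_comp[OF PD(4) that] PD(2)] by (simp add: hom_diff_def)
    then show ?thesis
      using linear_mapD(1)[OF PD(4)]
      unfolding linear_map_def[of K] by (auto simp: hom_complex_def hom_diff_def)
  qed
  fix \<phi> :: "'p \<Rightarrow> 'n" and n
  assume "\<phi> \<in> carrier (hom_complex A P N n)"
  then have "linear_map A (P n) N \<phi>" by (simp add: hom_complex_def)
  then show "hom_diff P d (Suc n) (hom_diff P d n \<phi>) = \<zero>\<^bsub>hom_complex A P N (Suc (Suc n))\<^esub>"
    using linear_mapD(1)[OF PD(4)] linear_map_zero[OF _ PD(2) N]
    by (auto simp: hom_complex_def hom_diff_def PD(9) intro!: restrict_ext)
qed

section \<open>Pullback along comparison maps, and its homotopy invariance\<close>

lemma hom_pullback_cochain_map: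
  fixes N :: "('a, 'n) module" and Q :: "nat \<Rightarrow> ('a, 'q) module"
  assumes A: "assoc_algebra K A" and N: "left_module A N"
    and P: "projective_resolution A M P d \<epsilon>" and Q: "projective_resolution A M Q d' \<epsilon>'"
    and \<alpha>: "comparison_map A P d \<epsilon> Q d' \<epsilon>' \<alpha>"
  shows "cochain_map K (hom_complex A Q N) (hom_diff Q d') (hom_complex A P N) (hom_diff P d)
    (\<lambda>n \<phi>. \<lambda>p\<in>carrier (P n). \<phi> (\<alpha> n p))"
proof (intro cochain_map.intro cochain_map_axioms.intro hom_cochain_complex[OF A N P]
    hom_cochain_complex[OF A N Q])
  note PD = projective_resolutionD[OF P]
  have lin: "linear_map A (P n) (Q n) (\<alpha> n)"
    and chain: "p \<in> carrier (P (Suc n)) \<Longrightarrow> d' (Suc n) (\<alpha> (Suc n) p) = \<alpha> n (d (Suc n) p)" for n p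
    using \<alpha> by (auto simp: comparison_map_def)
  fix n
  interpret P: left_module A "P n" by (rule PD(2))
  have "linear_map A (P n) N (\<lambda>p\<in>carrier (P n). \<phi> (\<alpha> n p))"
    if "linear_map A (Q n) N \<phi>" for \<phi> :: "'q \<Rightarrow> 'n"
    using linear_map_cong[OF linear_map_comp[OF lin that] PD(2)] by simp
  then show "linear_map K (hom_complex A Q N n) (hom_complex A P N n)
      (\<lambda>\<phi>. \<lambda>p\<in>carrier (P n). \<phi> (\<alpha> n p))"
    using linear_mapD(1)[OF lin]
    unfolding linear_map_def[of K] by (auto simp: hom_complex_def)
  fix \<phi> :: "'q \<Rightarrow> 'n"
  show "hom_diff P d n (\<lambda>p\<in>carrier (P n). \<phi> (\<alpha> n p)) =
      (\<lambda>p\<in>carrier (P (Suc n)). hom_diff Q d' n \<phi> (\<alpha> (Suc n) p))"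
    using linear_mapD(1)[OF lin] linear_mapD(1)[OF PD(4)] chain
    by (auto simp: hom_diff_def intro!: restrict_ext)
qed

text \<open>Write \<open>h = d' s + s d\<close>. The cocycle \<open>\<phi>\<close> kills the first
  term, so \<open>\<phi> h = (\<phi> s) d\<close> is the coboundary of
  \<open>\<phi> s\<close>.\<close>

lemma null_homotopic_pullback_coboundary:
  assumes N: "left_module A N"
    and P: "projective_resolution A M P d \<epsilon>" and Q: "projective_resolution A M Q d' \<epsilon>'"
    and lin: "\<And>n. linear_map A (P n) (Q n) (h n)"
    and aug: "\<And>p. p \<in> carrier (P 0) \<Longrightarrow> \<epsilon>' (h 0 p) = \<zero>\<^bsub>M\<^esub>"
    and chain: "\<And>n p. p \<in> carrier (P (Suc n)) \<Longrightarrow> d' (Suc n) (h (Suc n) p) = h n (d (Suc n) p)"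
    and \<phi>: "\<phi> \<in> cocycles (hom_complex A Q N) (hom_diff Q d') n"
  shows "(\<lambda>p\<in>carrier (P n). \<phi> (h n p)) \<in> coboundaries (hom_complex A P N) (hom_diff P d) n"
proof -
  note PD = projective_resolutionD[OF P] and QD = projective_resolutionD[OF Q]
  interpret N: left_module A N by fact
  have \<phi>_lin: "linear_map A (Q n) N \<phi>" using \<phi> by (simp add: cocycles_def hom_complex_def)
  have \<phi>_d: "\<phi> (d' (Suc n) q) = \<zero>\<^bsub>N\<^esub>" if "q \<in> carrier (Q (Suc n))" for q
  proof -
    have "hom_diff Q d' n \<phi> q = \<zero>\<^bsub>hom_complex A Q N (Suc n)\<^esub> q"
      using \<phi> by (simp add: cocycles_def)
    then show ?thesis using that by (simp add: hom_diff_def hom_complex_def)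
  qed
  obtain s where s: "\<And>n. linear_map A (P n) (Q (Suc n)) (s n)"
    and s0: "\<And>p. p \<in> carrier (P 0) \<Longrightarrow> d' (Suc 0) (s 0 p) = h 0 p"
    and ss: "\<And>n p. p \<in> carrier (P (Suc n)) \<Longrightarrow>
      d' (Suc (Suc n)) (s (Suc n) p) = h (Suc n) p \<ominus>\<^bsub>Q (Suc n)\<^esub> s n (d (Suc n) p)"
    using null_homotopy_exists[where h = h, OF P Q lin aug chain] by metis
  show ?thesis
  proof (cases n)
    case 0
    \<comment> \<open>There is no term \<open>s d\<close> in degree 0, so the pullback is zero, the
      only coboundary there.\<close>
    then have "\<phi> (h n p) = \<zero>\<^bsub>N\<^esub>" if "p \<in> carrier (P n)" for p
      using that s0[of p] \<phi>_d[of "s 0 p"] linear_mapD(1)[OF s, of p 0] by simp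
    then show ?thesis using 0 by (auto simp: coboundaries_def hom_complex_def intro: restrict_ext)
  next
    case (Suc m)
    interpret Qn: left_module A "Q n" by (rule QD(2))
    let ?\<psi> = "\<lambda>p\<in>carrier (P m). \<phi> (s m p)"
    have "\<phi> (h n p) = \<phi> (s m (d n p))" if p: "p \<in> carrier (P n)" for p
    proof -
      have hp: "h n p \<in> carrier (Q n)" "s m (d n p) \<in> carrier (Q n)"
        using p Suc linear_mapD(1)[OF lin] linear_mapD(1)[OF s] linear_mapD(1)[OF PD(4)] by auto
      then have "\<phi> (h n p) \<ominus>\<^bsub>N\<^esub> \<phi> (s m (d n p)) = \<phi> (h n p \<ominus>\<^bsub>Q n\<^esub> s m (d n p))"
        by (intro linear_map_minus[OF \<phi>_lin QD(2) N, symmetric])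
      also have "\<dots> = \<zero>\<^bsub>N\<^esub>"
        using ss[of p m] \<phi>_d[of "s n p"] linear_mapD(1)[OF s, of p n] p Suc by simp
      finally show ?thesis
        using hp linear_mapD(1)[OF \<phi>_lin] by (simp add: N.M.minus_eq_iff)
    qed
    then have "(\<lambda>p\<in>carrier (P n). \<phi> (h n p)) = hom_diff P d m ?\<psi>"
      using Suc linear_mapD(1)[OF PD(4)] by (auto simp: hom_diff_def intro!: restrict_ext)
    moreover have "?\<psi> \<in> carrier (hom_complex A P N m)"
      using linear_map_cong[OF linear_map_comp[OF s, of m N \<phi>] PD(2)] \<phi>_lin Suc
      by (simp add: hom_complex_def)
    ultimately show ?thesis using Suc by (auto simp: coboundaries_def)
  qed
qed

lemma comparison_map_comp:
  assumes "comparison_map R P d \<epsilon> Q d' \<epsilon>' \<alpha>" "comparison_map R Q d' \<epsilon>' L d'' \<epsilon>'' \<beta>"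
    and "\<And>n. linear_map R (P (Suc n)) (P n) (d (Suc n))"
  shows "comparison_map R P d \<epsilon> L d'' \<epsilon>'' (\<lambda>n p. \<beta> n (\<alpha> n p))"
  unfolding comparison_map_def
proof (intro conjI allI)
  show "linear_map R (P n) (L n) (\<lambda>p. \<beta> n (\<alpha> n p))" for n
    using assms(1,2) by (auto simp: comparison_map_def intro: linear_map_comp)
qed (use assms in \<open>auto simp: comparison_map_def linear_map_def Pi_iff\<close>)

text \<open>The difference \<open>\<gamma> - id\<close> is a linear chain map over zero, so it pulls
  cocycles back to coboundaries: a self-comparison acts on cohomology as the identity.\<close>

lemma comparison_map_self_coboundary:
  assumes A: "assoc_algebra K A" and M: "left_module A M" and N: "left_module A N"
    and P: "projective_resolution A M P d \<epsilon>" and \<gamma>: "comparison_map A P d \<epsilon> P d \<epsilon> \<gamma>"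
    and \<phi>: "\<phi> \<in> cocycles (hom_complex A P N) (hom_diff P d) n"
  shows "(\<lambda>p\<in>carrier (P n). \<phi> (\<gamma> n p)) \<ominus>\<^bsub>hom_complex A P N n\<^esub> \<phi> \<in>
    coboundaries (hom_complex A P N) (hom_diff P d) n"
proof -
  note PD = projective_resolutionD[OF P]
  interpret M: left_module A M by fact
  have \<gamma>_lin: "linear_map A (P n) (P n) (\<gamma> n)" for n using \<gamma> by (simp add: comparison_map_def)
  let ?h = "\<lambda>n p. \<gamma> n p \<ominus>\<^bsub>P n\<^esub> p"
  have id: "linear_map A (P n) (P n) (\<lambda>p. p)" for n by (simp add: linear_map_def)
  have lin: "linear_map A (P n) (P n) (?h n)" for n
    by (rule linear_map_diff[OF \<gamma>_lin id PD(2)])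
  have aug: "\<epsilon> (?h 0 p) = \<zero>\<^bsub>M\<^esub>" if "p \<in> carrier (P 0)" for p
    using linear_map_minus[OF PD(3,2) M] that linear_mapD(1)[OF \<gamma>_lin] linear_mapD(1)[OF PD(3)] \<gamma>
    by (simp add: comparison_map_def M.M.minus_eq M.M.r_neg)
  have chain: "d (Suc n) (?h (Suc n) p) = ?h n (d (Suc n) p)" if "p \<in> carrier (P (Suc n))" for n p
    using linear_map_minus[OF PD(4,2,2)] that linear_mapD(1)[OF \<gamma>_lin] \<gamma>
    by (simp add: comparison_map_def)
  have \<phi>': "\<phi> \<in> carrier (hom_module A (P n) N)" using \<phi> by (simp add: cocycles_def hom_complex_def)
  then have \<phi>_lin: "linear_map A (P n) N \<phi>" by simp
  have "(\<lambda>p\<in>carrier (P n). \<phi> (\<gamma> n p)) \<in> carrier (hom_module A (P n) N)"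
    using linear_map_cong[OF linear_map_comp[OF \<gamma>_lin \<phi>_lin] PD(2)] by simp
  then have "(\<lambda>p\<in>carrier (P n). \<phi> (\<gamma> n p)) \<ominus>\<^bsub>hom_complex A P N n\<^esub> \<phi> =
      (\<lambda>p\<in>carrier (P n). \<phi> (\<gamma> n p) \<ominus>\<^bsub>N\<^esub> \<phi> p)"
    using \<phi>' by (auto simp: hom_complex_def hom_module_minus[OF A PD(2) N] intro: restrict_ext)
  also have "\<dots> = (\<lambda>p\<in>carrier (P n). \<phi> (?h n p))"
    using linear_mapD(1)[OF \<gamma>_lin] linear_map_minus[OF \<phi>_lin PD(2) N]
    by (intro restrict_ext) simp
  also have "\<dots> \<in> coboundaries (hom_complex A P N) (hom_diff P d) n"
    by (rule null_homotopic_pullback_coboundary[where h = ?h, OF N P P lin aug chain \<phi>])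
  finally show ?thesis .
qed

text \<open>There is also a comparison map back from \<open>Q\<close> to \<open>P\<close>, and both
  composites are self-comparisons, hence the identity on cohomology.\<close>

lemma hom_pullback_cohomology_iso:
  assumes A: "assoc_algebra K A" and M: "left_module A M" and N: "left_module A N"
    and P: "projective_resolution A M P d \<epsilon>" and Q: "projective_resolution A M Q d' \<epsilon>'"
    and \<alpha>: "comparison_map A P d \<epsilon> Q d' \<epsilon>' \<alpha>"
  shows "linear_iso K (hom_cohomology A Q d' N n) (hom_cohomology A P d N n)
    (cohomology_map (hom_complex A P N) (hom_diff P d) (\<lambda>n \<phi>. \<lambda>p\<in>carrier (P n). \<phi> (\<alpha> n p)) n)"
proof -
  note PD = projective_resolutionD[OF P] and QD = projective_resolutionD[OF Q]
  obtain \<beta> where \<beta>: "comparison_map A Q d' \<epsilon>' P d \<epsilon> \<beta>"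
    using comparison_map_exists[OF M Q P] by auto
  have lin: "linear_map A (P n) (Q n) (\<alpha> n)" "linear_map A (Q n) (P n) (\<beta> n)" for n
    using \<alpha> \<beta> by (auto simp: comparison_map_def)
  show ?thesis
    unfolding hom_cohomology_def
  proof (rule cohomology_map_iso[OF hom_pullback_cochain_map[OF A N P Q \<alpha>]
        hom_pullback_cochain_map[OF A N Q P \<beta>]])
    fix n \<phi> assume "\<phi> \<in> cocycles (hom_complex A Q N) (hom_diff Q d') n"
    from comparison_map_self_coboundary[OF A M N Q comparison_map_comp[OF \<beta> \<alpha> QD(4)] this]
    show "(\<lambda>q\<in>carrier (Q n). (\<lambda>p\<in>carrier (P n). \<phi> (\<alpha> n p)) (\<beta> n q))
        \<ominus>\<^bsub>hom_complex A Q N n\<^esub> \<phi> \<in> coboundaries (hom_complex A Q N) (hom_diff Q d') n"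
      using linear_mapD(1)[OF lin(2)] by (simp cong: restrict_cong)
  next
    fix n \<phi> assume "\<phi> \<in> cocycles (hom_complex A P N) (hom_diff P d) n"
    from comparison_map_self_coboundary[OF A M N P comparison_map_comp[OF \<alpha> \<beta> PD(4)] this]
    show "(\<lambda>p\<in>carrier (P n). (\<lambda>q\<in>carrier (Q n). \<phi> (\<beta> n q)) (\<alpha> n p))
        \<ominus>\<^bsub>hom_complex A P N n\<^esub> \<phi> \<in> coboundaries (hom_complex A P N) (hom_diff P d) n"
      using linear_mapD(1)[OF lin(1)] by (simp cong: restrict_cong)
  qed
qed

section \<open>The canonical isomorphisms onto Ext\<close>

lemma Ext_iso_pullback:
  assumes M: "left_module A M" and P: "projective_resolution A M P d \<epsilon>"
  obtains \<alpha> where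
    "comparison_map A (std_resolution A M) (\<lambda>_. std_diff A) (std_aug A M) P d \<epsilon> \<alpha>"
    "Ext_iso A M N P d \<epsilon> = cohomology_map (hom_complex A (std_resolution A M) N)
      (hom_diff (std_resolution A M) (\<lambda>_. std_diff A))
      (\<lambda>n \<phi>. \<lambda>u\<in>carrier (std_resolution A M n). \<phi> (\<alpha> n u))"
  \<comment> \<open>Since a comparison map exists, the \<open>SOME\<close> in \<open>Ext_iso\<close>
    returns one.\<close>
  using someI_ex[OF comparison_map_exists[OF M std_resolution_projective_resolution[OF M] P]]
  by (auto simp: Ext_iso_def Let_def)

lemma Ext_iso_linear_iso:
  assumes A: "assoc_algebra K A" and M: "left_module A M" and N: "left_module A N"
    and P: "projective_resolution A M P d \<epsilon>"
  shows "linear_iso K (hom_cohomology A P d N n) (Ext A M N n) (Ext_iso A M N P d \<epsilon> n)"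
proof -
  obtain \<alpha> where "comparison_map A (std_resolution A M) (\<lambda>_. std_diff A) (std_aug A M) P d \<epsilon> \<alpha>"
    "Ext_iso A M N P d \<epsilon> = cohomology_map (hom_complex A (std_resolution A M) N)
      (hom_diff (std_resolution A M) (\<lambda>_. std_diff A))
      (\<lambda>n \<phi>. \<lambda>u\<in>carrier (std_resolution A M n). \<phi> (\<alpha> n u))"
    by (rule Ext_iso_pullback[OF M P])
  then show ?thesis
    \<comment> \<open>The standard resolution is the source of the comparison map, so its Hom
      cohomology, which is \<open>Ext\<close>, is the target of the pullback.\<close>
    using hom_pullback_cohomology_iso[OF A M N std_resolution_projective_resolution[OF M] P]
    by (simp add: Ext_def)
qed


section \<open>Operators over a derivation\<close>

lemma linear_derivationD:
  assumes "linear_derivation K A \<delta>"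
  shows "a \<in> carrier A \<Longrightarrow> \<delta> a \<in> carrier A"
    and "a \<in> carrier A \<Longrightarrow> b \<in> carrier A \<Longrightarrow> \<delta> (a \<oplus>\<^bsub>A\<^esub> b) = \<delta> a \<oplus>\<^bsub>A\<^esub> \<delta> b"
    and "a \<in> carrier A \<Longrightarrow> b \<in> carrier A \<Longrightarrow>
      \<delta> (a \<otimes>\<^bsub>A\<^esub> b) = \<delta> a \<otimes>\<^bsub>A\<^esub> b \<oplus>\<^bsub>A\<^esub> a \<otimes>\<^bsub>A\<^esub> \<delta> b"
    and "c \<in> carrier K \<Longrightarrow> a \<in> carrier A \<Longrightarrow> \<delta> (c \<odot>\<^bsub>A\<^esub> a) = c \<odot>\<^bsub>A\<^esub> \<delta> a"
  using assms by (auto simp: linear_derivation_def linear_map_def)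

lemma delta_operatorD:
  assumes "delta_operator K A \<delta> M f"
  shows "x \<in> carrier M \<Longrightarrow> f x \<in> carrier M"
    and "x \<in> carrier M \<Longrightarrow> y \<in> carrier M \<Longrightarrow> f (x \<oplus>\<^bsub>M\<^esub> y) = f x \<oplus>\<^bsub>M\<^esub> f y"
    and "a \<in> carrier A \<Longrightarrow> x \<in> carrier M \<Longrightarrow>
      f (a \<odot>\<^bsub>M\<^esub> x) = \<delta> a \<odot>\<^bsub>M\<^esub> x \<oplus>\<^bsub>M\<^esub> a \<odot>\<^bsub>M\<^esub> f x"
    and "c \<in> carrier K \<Longrightarrow> x \<in> carrier M \<Longrightarrow>
      f ((c \<odot>\<^bsub>A\<^esub> \<one>\<^bsub>A\<^esub>) \<odot>\<^bsub>M\<^esub> x) = (c \<odot>\<^bsub>A\<^esub> \<one>\<^bsub>A\<^esub>) \<odot>\<^bsub>M\<^esub> f x"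
  using assms by (auto simp: delta_operator_def linear_map_def)

text \<open>In \<open>f (h (a p))\<close> and in \<open>h (g (a p))\<close> the Leibniz rule
  produces the same extra term, \<open>\<delta> a\<close> acting on \<open>h p\<close>, which
  cancels in the difference.\<close>

lemma delta_operator_commutator_linear:
  assumes \<delta>: "linear_derivation K A \<delta>" and P: "left_module A P" and Q: "left_module A Q"
    and g: "delta_operator K A \<delta> P g" and f: "delta_operator K A \<delta> Q f" and h: "linear_map A P Q h"
  shows "linear_map A P Q (\<lambda>p. f (h p) \<ominus>\<^bsub>Q\<^esub> h (g p))"
proof -
  interpret P: left_module A P by fact
  interpret Q: left_module A Q by fact
  note simps = linear_mapD[OF h] delta_operatorD(1-3)[OF f] delta_operatorD(1-3)[OF g]
    linear_derivationD(1)[OF \<delta>]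
  show ?thesis
    unfolding linear_map_def
    by (auto simp: simps Q.M.add_minus_add Q.smult_minus) (simp add: simps Q.M.minus_eq Q.M.r_neg)
qed

text \<open>The Leibniz term is contributed by \<open>g\<close> alone, so a linear correction does
  not disturb it; \<open>t\<close> is also \<open>K\<close>-linear because scalars act through
  \<open>A\<close>.\<close>

lemma delta_operator_add_linear:
  assumes A: "assoc_algebra K A" and P: "left_module A P" and \<delta>: "linear_derivation K A \<delta>"
    and g: "delta_operator K A \<delta> P g" and t: "linear_map A P P t"
  shows "delta_operator K A \<delta> P (\<lambda>p. g p \<oplus>\<^bsub>P\<^esub> t p)"
proof -
  interpret A: assoc_algebra K A by fact
  interpret P: left_module A P by fact
  show ?thesis
    unfolding delta_operator_def linear_map_def[of K]
    by (auto simp: linear_mapD[OF t] delta_operatorD(1,2,4)[OF g] P.smult_r_distr P.M.a_ac)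
       (simp add: linear_mapD[OF t] delta_operatorD[OF g] P.smult_r_distr P.M.a_ac
         linear_derivationD(1)[OF \<delta>])
qed

lemma free_module_delta_operator:
  assumes A: "assoc_algebra K A" and \<delta>: "linear_derivation K A \<delta>"
  shows "delta_operator K A \<delta> (free_module A X) (\<lambda>u x. \<delta> (u x))"
proof -
  interpret A: assoc_algebra K A by fact
  note simps = linear_derivationD[OF \<delta>]
  \<comment> \<open>Once \<open>\<delta>\<close> fixes zero, applying it to coefficients cannot
    enlarge a support, which therefore stays finite.\<close>
  have "\<delta> \<zero>\<^bsub>A\<^esub> \<oplus>\<^bsub>A\<^esub> \<delta> \<zero>\<^bsub>A\<^esub> = \<delta> \<zero>\<^bsub>A\<^esub>"
    using simps(2)[of "\<zero>\<^bsub>A\<^esub>" "\<zero>\<^bsub>A\<^esub>"] by simp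
  then have zero: "\<delta> \<zero>\<^bsub>A\<^esub> = \<zero>\<^bsub>A\<^esub>" using simps(1)[of "\<zero>\<^bsub>A\<^esub>"] by simp
  have "(\<lambda>x. \<delta> (u x)) \<in> carrier (free_module A X)" if "u \<in> carrier (free_module A X)" for u
  proof -
    have "{x. \<delta> (u x) \<noteq> \<zero>\<^bsub>A\<^esub>} \<subseteq> {x. u x \<noteq> \<zero>\<^bsub>A\<^esub>}" using zero by auto
    then show ?thesis
      using that by (auto simp: free_module_def simps(1) dest: finite_subset)
  qed
  then show ?thesis
    unfolding delta_operator_def linear_map_def
    by (auto simp: free_module_def simps A.scalar_mult)
qed

text \<open>Start from any operator \<open>g\<close> on \<open>P\<close>. Its defect
  \<open>f h - h g\<close> is linear with values in the image of \<open>h\<close>, so it lifts to a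
  linear \<open>t\<close>, and \<open>g + t\<close> is the operator sought.\<close>

lemma delta_operator_lift:
  assumes A: "assoc_algebra K A" and \<delta>: "linear_derivation K A \<delta>"
    and P: "projective_module A P" and N: "left_module A N" and h: "linear_map A P N h"
    and g: "delta_operator K A \<delta> P g" and f: "delta_operator K A \<delta> N f"
    and image: "\<And>p. p \<in> carrier P \<Longrightarrow> f (h p) \<in> h ` carrier P"
  shows "\<exists>g'. delta_operator K A \<delta> P g' \<and> (\<forall>p\<in>carrier P. h (g' p) = f (h p))"
proof -
  have PM: "left_module A P" using P by (simp add: projective_module_def)
  interpret P: left_module A P by fact
  interpret N: left_module A N by fact
  note closed = linear_mapD(1)[OF h] delta_operatorD(1)[OF f] delta_operatorD(1)[OF g]
  have "f (h p) \<ominus>\<^bsub>N\<^esub> h (g p) \<in> h ` carrier P" if "p \<in> carrier P" for p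
  proof -
    obtain q where "q \<in> carrier P" "f (h p) = h q" using image[OF \<open>p \<in> carrier P\<close>] by auto
    then show ?thesis
      using linear_map_minus[OF h PM N, of q "g p"] closed(3)[OF \<open>p \<in> carrier P\<close>]
      by (intro image_eqI[of _ _ "q \<ominus>\<^bsub>P\<^esub> g p"]) auto
  qed
  then obtain t where t: "linear_map A P P t"
    "\<And>p. p \<in> carrier P \<Longrightarrow> h (t p) = f (h p) \<ominus>\<^bsub>N\<^esub> h (g p)"
    using projective_lift_image[OF P PM N h delta_operator_commutator_linear[OF \<delta> PM N g f h]]
    by auto
  have "h (g p \<oplus>\<^bsub>P\<^esub> t p) = f (h p)" if "p \<in> carrier P" for p
    using that t(2) linear_mapD(2)[OF h] linear_mapD(1)[OF t(1)] closed
      N.M.minus_eq_iff[of "f (h p)" "h (g p)" "h (t p)"]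
    by (simp add: N.M.a_comm)
  then show ?thesis
    using delta_operator_add_linear[OF A PM \<delta> g t(1)] by auto
qed

text \<open>The recursion for comparison maps is repeated with \<open>delta_operator_lift\<close> in
  place of linear lifting; \<open>ex\<close> supplies in each degree the operator to be
  corrected.\<close>

lemma delta_lifting_exists:
  assumes A: "assoc_algebra K A" and \<delta>: "linear_derivation K A \<delta>" and M: "left_module A M"
    and f: "delta_operator K A \<delta> M f" and P: "projective_resolution A M P d \<epsilon>"
    and ex: "\<And>i. \<exists>g. delta_operator K A \<delta> (P i) g"
  shows "\<exists>fs. delta_lifting K A \<delta> f P d \<epsilon> fs"
proof -
  note PD = projective_resolutionD[OF P]
  \<comment> \<open>These operators need not be \<open>A\<close>-linear, so preservation of zero is
    read off from \<open>K\<close>-linearity on the base modules.\<close>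
  have zero: "g \<zero>\<^bsub>P n\<^esub> = \<zero>\<^bsub>P n\<^esub>" if "delta_operator K A \<delta> (P n) g" for n g
    using linear_map_zero[OF _ base_module_left_module[OF A PD(2)] base_module_left_module[OF A PD(2)]]
      that by (auto simp: delta_operator_def)
  have f0: "f \<zero>\<^bsub>M\<^esub> = \<zero>\<^bsub>M\<^esub>"
    using linear_map_zero[OF _ base_module_left_module[OF A M] base_module_left_module[OF A M]] f
    by (auto simp: delta_operator_def)
  \<comment> \<open>As for comparison maps, the last conjunct keeps the next lifting possible:
    \<open>g\<close> must preserve the image of the incoming differential.\<close>
  let ?good = "\<lambda>n g. delta_operator K A \<delta> (P n) g \<and>
    (n = 0 \<longrightarrow> (\<forall>p\<in>carrier (P 0). \<epsilon> (g p) = f (\<epsilon> p))) \<and>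
    (\<forall>p\<in>carrier (P (Suc n)). g (d (Suc n) p) \<in> d (Suc n) ` carrier (P (Suc n)))"
  have "\<exists>fs. \<forall>n. ?good n (fs n) \<and>
    (\<forall>p\<in>carrier (P (Suc n)). d (Suc n) (fs (Suc n) p) = fs n (d (Suc n) p))"
  proof (rule dependent_nat_choice)
    obtain g0 where g0: "delta_operator K A \<delta> (P 0) g0" using ex by auto
    obtain g where g: "delta_operator K A \<delta> (P 0) g" "\<forall>p\<in>carrier (P 0). \<epsilon> (g p) = f (\<epsilon> p)"
      using delta_operator_lift[OF A \<delta> PD(1) M PD(3) g0 f] linear_mapD(1)[OF PD(3)]
        delta_operatorD(1)[OF f] PD(5) by auto
    then have "?good 0 g"
      using delta_operatorD(1)[OF g(1)] linear_mapD(1)[OF PD(4)] f0 by (simp add: PD(6) PD(8))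
    then show "\<exists>g. ?good 0 g" by blast
  next
    fix a n assume a: "?good n a"
    obtain g0 where g0: "delta_operator K A \<delta> (P (Suc n)) g0" using ex by auto
    obtain g where g: "delta_operator K A \<delta> (P (Suc n)) g"
      "\<And>p. p \<in> carrier (P (Suc n)) \<Longrightarrow> d (Suc n) (g p) = a (d (Suc n) p)"
      using delta_operator_lift[OF A \<delta> PD(1) PD(2) PD(4) g0, of a] a by auto
    \<comment> \<open>Exactness applies since
      \<open>d (g (d p)) = a (d (d p)) = a 0 = 0\<close>.\<close>
    then have "g (d (Suc (Suc n)) p) \<in> d (Suc (Suc n)) ` carrier (P (Suc (Suc n)))"
      if "p \<in> carrier (P (Suc (Suc n)))" for p
      using that a delta_operatorD(1)[OF g(1)] linear_mapD(1)[OF PD(4)] zero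
      by (simp add: PD(7) PD(9))
    then show "\<exists>g. ?good (Suc n) g \<and> (\<forall>p\<in>carrier (P (Suc n)). d (Suc n) (g p) = a (d (Suc n) p))"
      using g by (intro exI[of _ g]) auto
  qed
  then show ?thesis unfolding delta_lifting_def by metis
qed

section \<open>The operator on Hom complexes, and its compatibility with comparison maps\<close>

lemma sharp_cochain_map:
  assumes A: "assoc_algebra K A" and \<delta>: "linear_derivation K A \<delta>" and M: "left_module A M"
    and f: "delta_operator K A \<delta> M f" and P: "projective_resolution A M P d \<epsilon>"
    and fs: "delta_lifting K A \<delta> f P d \<epsilon> fs"
  shows "cochain_map K (hom_complex A P M) (hom_diff P d) (hom_complex A P M) (hom_diff P d)
    (sharp M f P fs)"
proof (intro cochain_map.intro cochain_map_axioms.intro hom_cochain_complex[OF A M P])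
  note PD = projective_resolutionD[OF P]
  interpret A: assoc_algebra K A by fact
  interpret M: left_module A M by fact
  have fsn: "delta_operator K A \<delta> (P n) (fs n)" for n using fs by (simp add: delta_lifting_def)
  note closed = delta_operatorD(1)[OF f] delta_operatorD(1)[OF fsn]
  fix n
  interpret P: left_module A "P n" by (rule PD(2))
  \<comment> \<open>Here \<open>\<phi>\<close> is itself a linear map between modules carrying
    \<open>\<delta>\<close>-operators, and \<open>sharp\<close> forms its commutator with
    them.\<close>
  have "linear_map A (P n) M (sharp M f P fs n \<phi>)" if "linear_map A (P n) M \<phi>" for \<phi>
    using linear_map_cong[OF delta_operator_commutator_linear[OF \<delta> PD(2) M fsn f that] PD(2)]
    by (simp add: sharp_def)
  moreover have "sharp M f P fs n \<phi> \<in> extensional (carrier (P n))" for \<phi>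
    by (simp add: sharp_def)
  moreover have "sharp M f P fs n (\<phi> \<oplus>\<^bsub>hom_module A (P n) M\<^esub> \<psi>) =
      sharp M f P fs n \<phi> \<oplus>\<^bsub>hom_module A (P n) M\<^esub> sharp M f P fs n \<psi>"
    if "linear_map A (P n) M \<phi>" "linear_map A (P n) M \<psi>" for \<phi> \<psi>
    using closed linear_mapD(1)[OF that(1)] linear_mapD(1)[OF that(2)]
    by (auto simp: sharp_def delta_operatorD(2)[OF f] M.M.add_minus_add intro!: restrict_ext)
  moreover have "sharp M f P fs n (c \<odot>\<^bsub>hom_module A (P n) M\<^esub> \<phi>) =
      c \<odot>\<^bsub>hom_module A (P n) M\<^esub> sharp M f P fs n \<phi>"
    if "c \<in> carrier K" "linear_map A (P n) M \<phi>" for c \<phi>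
    using closed linear_mapD(1)[OF that(2)] that(1)
    by (auto simp: sharp_def delta_operatorD(4)[OF f] M.smult_minus intro!: restrict_ext)
  ultimately show "linear_map K (hom_complex A P M n) (hom_complex A P M n) (sharp M f P fs n)"
    unfolding linear_map_def[of K] hom_complex_def
    by (simp del: hom_module_simps(2-4))
  fix \<phi> assume "\<phi> \<in> carrier (hom_complex A P M n)"
  \<comment> \<open>The two sides differ only in \<open>fs (d p)\<close> against
    \<open>d (fs p)\<close>, which agree because \<open>fs\<close> commutes with the
    differentials.\<close>
  show "hom_diff P d n (sharp M f P fs n \<phi>) = sharp M f P fs (Suc n) (hom_diff P d n \<phi>)"
    using closed linear_mapD(1)[OF PD(4)] fs
    by (auto simp: hom_diff_def sharp_def delta_lifting_def intro!: restrict_ext)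
qed

text \<open>On cohomology, pullback along \<open>\<alpha>\<close> thus intertwines the operators of
  the two resolutions for any choice of liftings; with \<open>\<alpha>\<close> the identity, this is
  independence of the lifting.\<close>

lemma sharp_pullback_coboundary:
  assumes A: "assoc_algebra K A" and \<delta>: "linear_derivation K A \<delta>" and M: "left_module A M"
    and f: "delta_operator K A \<delta> M f"
    and P: "projective_resolution A M P d \<epsilon>" and Q: "projective_resolution A M Q d' \<epsilon>'"
    and \<alpha>: "comparison_map A P d \<epsilon> Q d' \<epsilon>' \<alpha>"
    and gs: "delta_lifting K A \<delta> f P d \<epsilon> gs" and fs: "delta_lifting K A \<delta> f Q d' \<epsilon>' fs"
    and \<phi>: "\<phi> \<in> cocycles (hom_complex A Q M) (hom_diff Q d') n"
  shows "sharp M f P gs n (\<lambda>p\<in>carrier (P n). \<phi> (\<alpha> n p)) \<ominus>\<^bsub>hom_complex A P M n\<^esub>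
      (\<lambda>p\<in>carrier (P n). sharp M f Q fs n \<phi> (\<alpha> n p)) \<in>
    coboundaries (hom_complex A P M) (hom_diff P d) n"
proof -
  note PD = projective_resolutionD[OF P] and QD = projective_resolutionD[OF Q]
  interpret M: left_module A M by fact
  interpret \<alpha>: cochain_map K "hom_complex A Q M" "hom_diff Q d'" "hom_complex A P M" "hom_diff P d"
    "\<lambda>n \<phi>. \<lambda>p\<in>carrier (P n). \<phi> (\<alpha> n p)"
    by (rule hom_pullback_cochain_map[OF A M P Q \<alpha>])
  interpret S: cochain_map K "hom_complex A P M" "hom_diff P d" "hom_complex A P M" "hom_diff P d"
    "sharp M f P gs"
    by (rule sharp_cochain_map[OF A \<delta> M f P gs])
  interpret T: cochain_map K "hom_complex A Q M" "hom_diff Q d'" "hom_complex A Q M" "hom_diff Q d'"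
    "sharp M f Q fs"
    by (rule sharp_cochain_map[OF A \<delta> M f Q fs])
  have gsn: "delta_operator K A \<delta> (P n) (gs n)" and fsn: "delta_operator K A \<delta> (Q n) (fs n)" for n
    using gs fs by (auto simp: delta_lifting_def)
  have \<alpha>_lin: "linear_map A (P n) (Q n) (\<alpha> n)" for n using \<alpha> by (simp add: comparison_map_def)
  note closed = delta_operatorD(1)[OF f] delta_operatorD(1)[OF gsn] delta_operatorD(1)[OF fsn]
    linear_mapD(1)[OF \<alpha>_lin] linear_mapD(1)[OF PD(3)] linear_mapD(1)[OF PD(4)]
  let ?h = "\<lambda>n p. fs n (\<alpha> n p) \<ominus>\<^bsub>Q n\<^esub> \<alpha> n (gs n p)"
  have lin: "linear_map A (P n) (Q n) (?h n)" for n
    by (rule delta_operator_commutator_linear[OF \<delta> PD(2) QD(2) gsn fsn \<alpha>_lin])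
  \<comment> \<open>Since \<open>\<epsilon>' \<alpha> = \<epsilon>\<close> and both liftings cover
    \<open>f\<close>, both terms become \<open>f (\<epsilon> p)\<close>.\<close>
  have aug: "\<epsilon>' (?h 0 p) = \<zero>\<^bsub>M\<^esub>" if "p \<in> carrier (P 0)" for p
    using that linear_map_minus[OF QD(3,2) M] closed \<alpha> gs fs
    by (simp add: comparison_map_def delta_lifting_def M.M.minus_eq M.M.r_neg)
  have chain: "d' (Suc n) (?h (Suc n) p) = ?h n (d (Suc n) p)" if "p \<in> carrier (P (Suc n))" for n p
    using that linear_map_minus[OF QD(4,2,2)] closed \<alpha> gs fs
    by (simp add: comparison_map_def delta_lifting_def)
  have \<phi>_lin: "linear_map A (Q n) M \<phi>" using \<phi> by (simp add: cocycles_def hom_complex_def)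
  note closed = closed linear_mapD(1)[OF \<phi>_lin]
  \<comment> \<open>Membership in the Hom module is inherited from the cocycle property, which the
    three cochain maps preserve.\<close>
  have "sharp M f P gs n (\<lambda>p\<in>carrier (P n). \<phi> (\<alpha> n p)) \<in> carrier (hom_module A (P n) M)"
    and "(\<lambda>p\<in>carrier (P n). sharp M f Q fs n \<phi> (\<alpha> n p)) \<in> carrier (hom_module A (P n) M)"
    using \<alpha>.D.cocycles_closed(1)[OF S.map_cocycle[OF \<alpha>.map_cocycle[OF \<phi>]]]
      \<alpha>.D.cocycles_closed(1)[OF \<alpha>.map_cocycle[OF T.map_cocycle[OF \<phi>]]]
    unfolding hom_complex_def by blast+
  then have "sharp M f P gs n (\<lambda>p\<in>carrier (P n). \<phi> (\<alpha> n p)) \<ominus>\<^bsub>hom_complex A P M n\<^esub>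
      (\<lambda>p\<in>carrier (P n). sharp M f Q fs n \<phi> (\<alpha> n p)) =
      (\<lambda>p\<in>carrier (P n). sharp M f P gs n (\<lambda>p\<in>carrier (P n). \<phi> (\<alpha> n p)) p \<ominus>\<^bsub>M\<^esub>
        (\<lambda>p\<in>carrier (P n). sharp M f Q fs n \<phi> (\<alpha> n p)) p)"
    unfolding hom_complex_def by (rule hom_module_minus[OF A PD(2) M])
  also have "\<dots> = (\<lambda>p\<in>carrier (P n). \<phi> (?h n p))"
    using closed by (intro restrict_ext) (simp add: sharp_def linear_map_minus[OF \<phi>_lin QD(2) M] M.M.minus_minus_cancel)
  also have "\<dots> \<in> coboundaries (hom_complex A P M) (hom_diff P d) n"
    by (rule null_homotopic_pullback_coboundary[where h = ?h, OF M P Q lin aug chain \<phi>])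
  finally show ?thesis .
qed

text \<open>\<open>Ext_iso\<close> is the pullback along some comparison map, so
  \<open>sharp_pullback_coboundary\<close> settles the square on representing cocycles.
  \<open>D\<close> is prescribed only on the carrier of \<open>Ext\<close>, to accommodate the
  restricted map of the theorem.\<close>

lemma nabla_square_std:
  assumes A: "assoc_algebra K A" and \<delta>: "linear_derivation K A \<delta>" and M: "left_module A M"
    and f: "delta_operator K A \<delta> M f" and P: "projective_resolution A M P d \<epsilon>"
    and fs: "delta_lifting K A \<delta> f P d \<epsilon> fs"
    and gs: "delta_lifting K A \<delta> f (std_resolution A M) (\<lambda>_. std_diff A) (std_aug A M) gs"
    and D: "\<And>n x. x \<in> carrier (Ext A M M n) \<Longrightarrow>
      D n x = nabla_res A M f (std_resolution A M) (\<lambda>_. std_diff A) gs n x"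
  shows "nabla_square A M f D P d \<epsilon> fs"
  unfolding nabla_square_def
proof (intro allI ballI)
  fix n x assume x: "x \<in> carrier (hom_cohomology A P d M n)"
  let ?F = "std_resolution A M"
  note F = std_resolution_projective_resolution[OF M]
  obtain \<alpha> where \<alpha>: "comparison_map A ?F (\<lambda>_. std_diff A) (std_aug A M) P d \<epsilon> \<alpha>"
    and iso: "Ext_iso A M M P d \<epsilon> = cohomology_map (hom_complex A ?F M)
      (hom_diff ?F (\<lambda>_. std_diff A)) (\<lambda>n \<phi>. \<lambda>u\<in>carrier (?F n). \<phi> (\<alpha> n u))"
    by (rule Ext_iso_pullback[OF M P])
  interpret \<alpha>: cochain_map K "hom_complex A P M" "hom_diff P d" "hom_complex A ?F M"
    "hom_diff ?F (\<lambda>_. std_diff A)" "\<lambda>n \<phi>. \<lambda>u\<in>carrier (?F n). \<phi> (\<alpha> n u)"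
    by (rule hom_pullback_cochain_map[OF A M F P \<alpha>])
  interpret S: cochain_map K "hom_complex A ?F M" "hom_diff ?F (\<lambda>_. std_diff A)"
    "hom_complex A ?F M" "hom_diff ?F (\<lambda>_. std_diff A)" "sharp M f ?F gs"
    by (rule sharp_cochain_map[OF A \<delta> M f F gs])
  interpret T: cochain_map K "hom_complex A P M" "hom_diff P d" "hom_complex A P M" "hom_diff P d"
    "sharp M f P fs"
    by (rule sharp_cochain_map[OF A \<delta> M f P fs])
  obtain \<phi> where \<phi>: "\<phi> \<in> cocycles (hom_complex A P M) (hom_diff P d) n"
    and x_eq: "x = cohomology_class (hom_complex A P M) (hom_diff P d) n \<phi>"
    using x by (auto simp: hom_cohomology_def \<alpha>.C.cohomology_carrier)
  let ?\<phi>\<alpha> = "\<lambda>u\<in>carrier (?F n). \<phi> (\<alpha> n u)"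
  have Ext_x: "Ext_iso A M M P d \<epsilon> n x =
      cohomology_class (hom_complex A ?F M) (hom_diff ?F (\<lambda>_. std_diff A)) n ?\<phi>\<alpha>"
    unfolding iso x_eq by (rule \<alpha>.cohomology_map_class[OF \<phi>])
  also have "\<dots> \<in> carrier (Ext A M M n)"
    unfolding Ext_def hom_cohomology_def \<alpha>.D.cohomology_carrier
    by (rule imageI[OF \<alpha>.map_cocycle[OF \<phi>]])
  finally have "D n (Ext_iso A M M P d \<epsilon> n x) =
      nabla_res A M f ?F (\<lambda>_. std_diff A) gs n (Ext_iso A M M P d \<epsilon> n x)"
    by (rule D)
  also have "\<dots> = cohomology_class (hom_complex A ?F M) (hom_diff ?F (\<lambda>_. std_diff A)) n
      (sharp M f ?F gs n ?\<phi>\<alpha>)"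
    unfolding Ext_x nabla_res_def by (rule S.cohomology_map_class[OF \<alpha>.map_cocycle[OF \<phi>]])
  also have "\<dots> = cohomology_class (hom_complex A ?F M) (hom_diff ?F (\<lambda>_. std_diff A)) n
      (\<lambda>u\<in>carrier (?F n). sharp M f P fs n \<phi> (\<alpha> n u))"
    using sharp_pullback_coboundary[OF A \<delta> M f F P \<alpha> gs fs \<phi>]
    by (intro \<alpha>.D.class_eq_iff[THEN iffD2] \<alpha>.D.cocycles_closed(1) S.map_cocycle
        \<alpha>.map_cocycle T.map_cocycle \<phi>)
  also have "\<dots> = Ext_iso A M M P d \<epsilon> n (nabla_res A M f P d fs n x)"
    unfolding iso x_eq nabla_res_def T.cohomology_map_class[OF \<phi>]
    by (rule \<alpha>.cohomology_map_class[OF T.map_cocycle[OF \<phi>], symmetric])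
  finally show "Ext_iso A M M P d \<epsilon> n (nabla_res A M f P d fs n x) =
      D n (Ext_iso A M M P d \<epsilon> n x)" by (rule sym)
qed

text \<open>Types cannot be quantified inside the statement, hence the resolutions range over two
  types. Those of the type of the standard resolution already determine \<open>D\<close>, so it is
  the same for every \<open>'p\<close>. Extensionality makes uniqueness an equality of
  functions.\<close>

theorem theorem1:
  fixes K :: "'k ring" and A :: "('k, 'a) module" and \<delta> :: "'a \<Rightarrow> 'a"
    and M :: "('a, 'm) module" and f :: "'m \<Rightarrow> 'm"
  assumes "assoc_algebra K A"
    and "projective_module K A"
    and "linear_derivation K A \<delta>"
    and "left_module A M"
    and "delta_operator K A \<delta> M f"
  shows "\<exists>!D.
    (\<forall>n. D n \<in> extensional (carrier (Ext A M M n)) \<and>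
         linear_map K (Ext A M M n) (Ext A M M n) (D n)) \<and>
    (\<forall>(P :: nat \<Rightarrow> ('a, ('a, 'm) label \<Rightarrow> 'a) module) d \<epsilon>.
       projective_resolution A M P d \<epsilon> \<longrightarrow>
       (\<forall>n. linear_iso K (hom_cohomology A P d M n) (Ext A M M n) (Ext_iso A M M P d \<epsilon> n)) \<and>
       (\<forall>fs. delta_lifting K A \<delta> f P d \<epsilon> fs \<longrightarrow> nabla_square A M f D P d \<epsilon> fs)) \<and>
    (\<forall>(P :: nat \<Rightarrow> ('a, 'p) module) d \<epsilon>.
       projective_resolution A M P d \<epsilon> \<longrightarrow>
       (\<forall>n. linear_iso K (hom_cohomology A P d M n) (Ext A M M n) (Ext_iso A M M P d \<epsilon> n)) \<and>
       (\<forall>fs. delta_lifting K A \<delta> f P d \<epsilon> fs \<longrightarrow> nabla_square A M f D P d \<epsilon> fs))"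
proof -
  note A = assms(1) and \<delta> = assms(3) and M = assms(4) and f = assms(5)
  let ?F = "std_resolution A M" and ?d = "\<lambda>_ :: nat. std_diff A" and ?\<epsilon> = "std_aug A M"
  note F = std_resolution_projective_resolution[OF M]
  have "\<exists>g. delta_operator K A \<delta> (?F i) g" for i
    unfolding std_resolution_def using free_module_delta_operator[OF A \<delta>] by blast
  then obtain gs where gs: "delta_lifting K A \<delta> f ?F ?d ?\<epsilon> gs"
    using delta_lifting_exists[OF A \<delta> M f F] by auto
  interpret S: cochain_map K "hom_complex A ?F M" "hom_diff ?F ?d"
    "hom_complex A ?F M" "hom_diff ?F ?d" "sharp M f ?F gs"
    by (rule sharp_cochain_map[OF A \<delta> M f F gs])
  note iso = Ext_iso_linear_iso[OF A M M]
  \<comment> \<open>The restriction makes \<open>D n\<close> extensional; on classes it is the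
    operator computed from the lifting \<open>gs\<close>.\<close>
  define D where "D n = restrict (nabla_res A M f ?F ?d gs n) (carrier (Ext A M M n))" for n
  have D: "D n x = nabla_res A M f ?F ?d gs n x" if "x \<in> carrier (Ext A M M n)" for n x
    using that by (simp add: D_def)
  show ?thesis
  proof (rule ex1I[of _ D], intro conjI allI impI)
    fix n
    show "D n \<in> extensional (carrier (Ext A M M n))" by (simp add: D_def)
    have "linear_map K (Ext A M M n) (Ext A M M n) (nabla_res A M f ?F ?d gs n)"
      unfolding Ext_def hom_cohomology_def nabla_res_def by (rule S.cohomology_map_linear)
    \<comment> \<open>Sums and multiples of classes are classes, so linearity survives the
      restriction to the carrier.\<close>
    moreover have "x \<oplus>\<^bsub>Ext A M M n\<^esub> y \<in> carrier (Ext A M M n)"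
      and "c \<in> carrier K \<Longrightarrow> c \<odot>\<^bsub>Ext A M M n\<^esub> x \<in> carrier (Ext A M M n)"
      if "x \<in> carrier (Ext A M M n)" "y \<in> carrier (Ext A M M n)" for x y c
      using that unfolding Ext_def hom_cohomology_def S.C.cohomology_carrier
      by (auto simp: S.C.cohomology_add S.C.cohomology_smult S.C.cocycles_closed)
    ultimately show "linear_map K (Ext A M M n) (Ext A M M n) (D n)"
      unfolding linear_map_def by (auto simp: D)
  next
    fix D'
    assume D': "(\<forall>n. D' n \<in> extensional (carrier (Ext A M M n)) \<and>
         linear_map K (Ext A M M n) (Ext A M M n) (D' n)) \<and>
      (\<forall>(P :: nat \<Rightarrow> ('a, ('a, 'm) label \<Rightarrow> 'a) module) d \<epsilon>.
         projective_resolution A M P d \<epsilon> \<longrightarrow>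
         (\<forall>n. linear_iso K (hom_cohomology A P d M n) (Ext A M M n) (Ext_iso A M M P d \<epsilon> n)) \<and>
         (\<forall>fs. delta_lifting K A \<delta> f P d \<epsilon> fs \<longrightarrow> nabla_square A M f D' P d \<epsilon> fs)) \<and>
      (\<forall>(P :: nat \<Rightarrow> ('a, 'p) module) d \<epsilon>.
         projective_resolution A M P d \<epsilon> \<longrightarrow>
         (\<forall>n. linear_iso K (hom_cohomology A P d M n) (Ext A M M n) (Ext_iso A M M P d \<epsilon> n)) \<and>
         (\<forall>fs. delta_lifting K A \<delta> f P d \<epsilon> fs \<longrightarrow> nabla_square A M f D' P d \<epsilon> fs))"
    \<comment> \<open>The standard resolution with the lifting \<open>gs\<close> is among the
      admissible data, so any competitor \<open>D'\<close> makes its square commute.\<close>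
    have sq: "nabla_square A M f D' ?F ?d ?\<epsilon> gs"
      by (rule D'[THEN conjunct2, THEN conjunct1, rule_format, OF F, THEN conjunct2,
            rule_format, OF gs])
    have sq': "nabla_square A M f D ?F ?d ?\<epsilon> gs"
      by (rule nabla_square_std[OF A \<delta> M f F gs gs D])
    show "D' = D"
    proof
      fix n
      have "D' n y = D n y" if y: "y \<in> carrier (Ext A M M n)" for y
      proof -
        \<comment> \<open>\<open>Ext_iso\<close> of the standard resolution is onto, and at each of
          its values the two squares prescribe the same result for \<open>D'\<close> and
          \<open>D\<close>.\<close>
        obtain x where "x \<in> carrier (hom_cohomology A ?F ?d M n)" "y = Ext_iso A M M ?F ?d ?\<epsilon> n x"
          using y iso[OF F, of n] by (auto simp: linear_iso_def bij_betw_def)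
        then show ?thesis using sq sq' by (simp add: nabla_square_def)
      qed
      then show "D' n = D n"
        using D' by (intro extensionalityI[of _ "carrier (Ext A M M n)"]) (auto simp: D_def)
    qed
  qed (rule iso nabla_square_std[OF A \<delta> M f _ _ gs D]; assumption)+
qed

end
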